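(* Let $\mathcal{Y}=\{0,1\}$, let $P_{XY}$ be a probability distribution on $\mathcal{X}\times\mathcal{Y}$ with $p=\Pr[Y=1]>0$, and let $D(r)=r^{-\beta}$, where $\beta\in(0,1)$. Let $k=cn$ for some constant $c\in(0,1)$, and define $\tilde D(r)=D(r)$ if $r\le k$ and $\tilde D(r)=0$ otherwise. Let $f:\mathcal{X}\to\mathbb{R}$ be a ranking function such that $f(X)$ has an atomless distribution and $\overline{y}^f(s)=\Pr[Y=1\mid\tilde f(X)=s]$ is a continuous function of $s\in[0,1]$. Then, as $n\to\infty$, $$\mathrm{NDCG}_{\tilde D}(f,S_n)\overset{p}{\to}\frac{1-\beta}{(\min\{c,p\})^{1-\beta}}\cdot\int_{1-c}^1\overline{y}^f(s)\,(1-s)^{-\beta}\,\mathrm{d}s,$$ where $\overset{p}{\to}$ denotes convergence in probability.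
   Context: $(X,Y)\sim P_{XY}$; $(x_1,y_1),(x_2,y_2),\ldots$ are i.i.d. from $P_{XY}$ and $S_n=\{(x_1,y_1),\ldots,(x_n,y_n)\}$. A ranking function is a measurable map $f:\mathcal{X}\to\mathbb{R}$. It orders $x_1,\ldots,x_n$ by decreasing score, giving $x^f_{(1)},\ldots,x^f_{(n)}$ with $f(x^f_{(1)})\ge\cdots\ge f(x^f_{(n)})$, ties being broken by a fixed rule not depending on the labels; $y^f_{(r)}$ denotes the label of $x^f_{(r)}$. For a discount $D$ (possibly depending on $n$), $\mathrm{DCG}_D(f,S_n)=\sum_{r=1}^n y^f_{(r)}D(r)$; $\mathrm{IDCG}_D(S_n)$ is the maximum of this sum over all orderings of the $n$ items; $\mathrm{NDCG}_D(f,S_n)=\mathrm{DCG}_D(f,S_n)/\mathrm{IDCG}_D(S_n)$ (equal to $1$ by convention when $\mathrm{IDCG}_D(S_n)=0$). The canonical version of $f$ is $\tilde f(x)=\Pr_{X\sim P_X}[f(X)\le f(x)]$; when $f(X)$ is atomless, $\tilde f(X)$ is uniform on $[0,1]$. *)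

theory Defs
  imports "HOL-Probability.Probability"
begin

text \<open>Items and ranks of a sample of size \<open>n\<close> are both numbered from 1 to \<open>n\<close>; an ordering \<open>\<pi>\<close>
  is a permutation sending the rank \<open>r\<close> to the item \<open>\<pi> r\<close> placed there. The function \<open>y\<close> gives
  the labels of the items.\<close>

definition dcg :: "(nat \<Rightarrow> real) \<Rightarrow> nat \<Rightarrow> (nat \<Rightarrow> nat) \<Rightarrow> (nat \<Rightarrow> nat) \<Rightarrow> real" where
  "dcg D n \<pi> y = (\<Sum>r=1..n. real (y (\<pi> r)) * D r)"

definition idcg :: "(nat \<Rightarrow> real) \<Rightarrow> nat \<Rightarrow> (nat \<Rightarrow> nat) \<Rightarrow> real" where
  "idcg D n y = Max ((\<lambda>\<pi>. dcg D n \<pi> y) ` {\<pi>. \<pi> permutes {1..n}})"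

text \<open>A rule that orders every sample by decreasing score \<open>f\<close>. The ordering returned for the items
  \<open>x\<close> is a (measurable) function of the items alone, so ties are resolved without looking at the
  labels; how they are resolved is otherwise unconstrained.\<close>

definition ranking_rule ::
    "'x measure \<Rightarrow> ('x \<Rightarrow> real) \<Rightarrow> (nat \<Rightarrow> (nat \<Rightarrow> 'x) \<Rightarrow> nat \<Rightarrow> nat) \<Rightarrow> bool" where
  "ranking_rule MX f \<rho> \<longleftrightarrow>
     (\<forall>n. \<forall>x \<in> space (PiM {1..n} (\<lambda>_. MX)).
        \<rho> n x permutes {1..n} \<and>
        (\<forall>r\<in>{1..n}. \<forall>s\<in>{1..n}. r \<le> s \<longrightarrow> f (x (\<rho> n x s)) \<le> f (x (\<rho> n x r)))) \<and>
     (\<forall>n. \<forall>r\<in>{1..n}.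
        (\<lambda>x. \<rho> n x r) \<in> measurable (PiM {1..n} (\<lambda>_. MX)) (count_space UNIV))"

definition ndcg ::
    "(nat \<Rightarrow> real) \<Rightarrow> (nat \<Rightarrow> (nat \<Rightarrow> 'x) \<Rightarrow> nat \<Rightarrow> nat) \<Rightarrow> nat \<Rightarrow> (nat \<Rightarrow> 'x \<times> nat) \<Rightarrow> real" where
  "ndcg D \<rho> n S =
     (let x = (\<lambda>i\<in>{1..n}. fst (S i)); y = (\<lambda>i. snd (S i)) in
      if idcg D n y = 0 then 1 else dcg D n (\<rho> n x) y / idcg D n y)"

definition cutoff_power_discount :: "real \<Rightarrow> real \<Rightarrow> nat \<Rightarrow> real" where
  "cutoff_power_discount \<beta> k r = (if real r \<le> k then real r powr (-\<beta>) else 0)"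

definition canonical :: "'x measure \<Rightarrow> ('x \<Rightarrow> real) \<Rightarrow> 'x \<Rightarrow> real" where
  "canonical PX f x = measure PX {x' \<in> space PX. f x' \<le> f x}"

text \<open>\<open>g\<close> is a version of the function \<open>s \<mapsto> Pr[A | T = s]\<close>: composed with \<open>T\<close>, it is the conditional
  expectation of the indicator of \<open>A\<close> given the sigma-algebra generated by \<open>T\<close>.\<close>

definition cond_prob_version ::
    "'a measure \<Rightarrow> 'a set \<Rightarrow> ('a \<Rightarrow> real) \<Rightarrow> (real \<Rightarrow> real) \<Rightarrow> bool" where
  "cond_prob_version M A T g \<longleftrightarrow>
     (AE z in M. real_cond_exp M (vimage_algebra (space M) T borel) (indicator A) z = g (T z))"

definition converges_in_prob :: "'w measure \<Rightarrow> (nat \<Rightarrow> 'w \<Rightarrow> real) \<Rightarrow> real \<Rightarrow> bool" where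
  "converges_in_prob M X L \<longleftrightarrow>
     (\<forall>n. X n \<in> borel_measurable M) \<and>
     (\<forall>\<epsilon>>0. (\<lambda>n. measure M {\<omega> \<in> space M. \<bar>X n \<omega> - L\<bar> > \<epsilon>}) \<longlonglongrightarrow> 0)"

end

theory Submission
  imports Defs
begin

text \<open>
  Let \<open>T = 1 - f~(X)\<close>, which is uniform on \<open>[0,1]\<close>, and \<open>G t = Pr[Y = 1, T \<le> t]\<close>. The items with
  \<open>T \<le> r / n\<close> form an initial segment of the ranking, so the number \<open>A r\<close> of positive labels among the
  top \<open>r\<close> items differs from the number of positive items with \<open>T \<le> r / n\<close> by at most the deviation
  from \<open>r\<close> of the number of all items with \<open>T \<le> r / n\<close>. Two variance bounds then give
  \<open>E \<bar>A r - n * G (r / n)\<bar> \<le> 2 * sqrt r\<close>. Summation by parts turns this into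
  \<open>E \<bar>DCG - n * (\<Sum>r. D r * (G (r / n) - G ((r - 1) / n)))\<bar> = O(n powr ((1 - \<beta>) / 2))\<close>, which is negligible
  against the normalisation \<open>n powr (1 - \<beta>)\<close>; only first moments and no uniform law of large numbers are
  involved. The deterministic sum is an expectation of a function of \<open>\<lceil>n T\<rceil>\<close> and converges by dominated
  convergence. By rearrangement, the ideal DCG is the sum of the discounts over as many ranks as there
  are positive labels, so its limit follows from the weak law for the number of positives.
\<close>

subsection \<open>Discounted sums and orderings\<close>

text \<open>A set of \<open>m\<close> positive integers has maximum at least \<open>m\<close>, so
  removing the maximum costs a term of size at most \<open>D m\<close>; induction on the cardinality
  does the rest. This is the optimality half of \<open>idcg_binary\<close>.\<close>

lemma sum_decreasing_le_initial:
  fixes D :: "nat \<Rightarrow> real"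
  assumes dec: "\<And>r s. 1 \<le> r \<Longrightarrow> r \<le> s \<Longrightarrow> D s \<le> D r"
    and "finite R" "R \<subseteq> {1..}"
  shows "sum D R \<le> (\<Sum>r=1..card R. D r)"
  using assms(2,3)
proof (induction "card R" arbitrary: R)
  case 0
  then show ?case by simp
next
  case (Suc m)
  define x where "x = Max R"
  have "R \<noteq> {}" using Suc.hyps(2) by auto
  then have x: "x \<in> R" "\<And>r. r \<in> R \<Longrightarrow> r \<le> x"
    using Suc.prems by (auto simp: x_def)
  have "R \<subseteq> {1..x}" using x Suc.prems by auto
  then have "card R \<le> x" using card_mono[of "{1..x}" R] by simp
  then have "D x \<le> D (Suc m)" using Suc.hyps(2) by (intro dec) auto
  moreover have c: "card (R - {x}) = m" using Suc x by simp
  moreover have "sum D (R - {x}) \<le> (\<Sum>r=1..m. D r)"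
    using Suc.hyps(1)[of "R - {x}"] c Suc.prems by auto
  moreover have "sum D R = D x + sum D (R - {x})"
    using Suc.prems x by (simp add: sum.remove)
  ultimately show ?case using Suc.hyps(2)[symmetric] by simp
qed

lemma sum_binary_eq_card:
  assumes "finite A" "\<And>i. i \<in> A \<Longrightarrow> y i \<in> {0, 1::nat}"
  shows "sum y A = card {i\<in>A. y i = 1}"
proof -
  have "sum y A = (\<Sum>i\<in>A. if y i = 1 then 1 else 0)"
    using assms(2) by (intro sum.cong) auto
  also have "\<dots> = card {i\<in>A. y i = 1}"
    using assms(1) by (simp add: sum.If_cases Int_def)
  finally show ?thesis .
qed

lemma permutes_image_Collect:
  assumes "\<pi> permutes A"
  shows "\<pi> ` {r\<in>A. Q (\<pi> r)} = {i\<in>A. Q i}"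
proof -
  have "\<pi> ` {r\<in>A. Q (\<pi> r)} = {i \<in> \<pi> ` A. Q i}" by blast
  then show ?thesis using permutes_image[OF assms] by simp
qed

text \<open>With binary labels the DCG of an ordering is the sum of \<open>D\<close> over the ranks
  held by positives. The number of these ranks does not depend on the ordering, so the maximum is
  reached by filling the first ranks with positives.\<close>

lemma idcg_binary:
  assumes dec: "\<And>r s. 1 \<le> r \<Longrightarrow> r \<le> s \<Longrightarrow> D s \<le> D r"
    and bin: "\<And>i. i \<in> {1..n} \<Longrightarrow> y i \<in> {0, 1}"
  shows "idcg D n y = (\<Sum>r=1..(\<Sum>i=1..n. y i). D r)"
proof -
  define N where "N = (\<Sum>i=1..n. y i)"
  have N: "N = card {i\<in>{1..n}. y i = 1}"
    unfolding N_def using bin by (intro sum_binary_eq_card) auto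
  have dcg_eq: "dcg D n \<pi> y = sum D {r\<in>{1..n}. y (\<pi> r) = 1}" if "\<pi> permutes {1..n}" for \<pi>
  proof -
    have "dcg D n \<pi> y = (\<Sum>r=1..n. if y (\<pi> r) = 1 then D r else 0)"
      unfolding dcg_def
    proof (intro sum.cong refl)
      fix r assume "r \<in> {1..n}"
      then have "\<pi> r \<in> {1..n}" using permutes_in_image[OF that] by blast
      then show "real (y (\<pi> r)) * D r = (if y (\<pi> r) = 1 then D r else 0)"
        using bin[of "\<pi> r"] by auto
    qed
    then show ?thesis by (simp add: sum.If_cases Int_def)
  qed
  have card_eq: "card {r\<in>{1..n}. y (\<pi> r) = 1} = N" if "\<pi> permutes {1..n}" for \<pi>
  proof -
    have "{i\<in>{1..n}. y i = 1} = \<pi> ` {r\<in>{1..n}. y (\<pi> r) = 1}"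
      using permutes_image_Collect[OF that, of "\<lambda>i. y i = 1"] by simp
    then show ?thesis
      unfolding N using permutes_inj_on[OF that] by (simp add: card_image)
  qed
  have "card {i\<in>{1..n}. y i = 1} \<le> card {1..n}" by (intro card_mono) auto
  then have "N \<le> n" unfolding N by simp
  \<comment> \<open>The optimal ordering is glued from \<open>g\<close>, which puts the positives on
    the first \<open>N\<close> ranks, and \<open>h\<close>, which puts the other items on the
    remaining ranks. It is the identity outside \<open>{1..n}\<close>, as \<open>permutes\<close>
    demands.\<close>
  obtain g where g: "bij_betw g {1..N} {i\<in>{1..n}. y i = 1}"
    using finite_same_card_bij[of "{1..N}" "{i\<in>{1..n}. y i = 1}"] N by auto
  have "card {N+1..n} = card ({1..n} - {i\<in>{1..n}. y i = 1})"
    using N by (subst card_Diff_subset) auto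
  then obtain h where h: "bij_betw h {N+1..n} ({1..n} - {i\<in>{1..n}. y i = 1})"
    using finite_same_card_bij[of "{N+1..n}" "{1..n} - {i\<in>{1..n}. y i = 1}"] by auto
  define \<pi> where "\<pi> r = (if r \<in> {1..N} then g r else if r \<in> {N+1..n} then h r else r)" for r
  have b1: "bij_betw \<pi> {1..N} {i\<in>{1..n}. y i = 1}"
    using g by (rule bij_betw_cong[THEN iffD1, rotated]) (auto simp: \<pi>_def)
  have b2: "bij_betw \<pi> {N+1..n} ({1..n} - {i\<in>{1..n}. y i = 1})"
    using h by (rule bij_betw_cong[THEN iffD1, rotated]) (auto simp: \<pi>_def)
  have un: "{1..N} \<union> {N+1..n} = {1..n}" using \<open>N \<le> n\<close> by auto
  have "bij_betw \<pi> ({1..N} \<union> {N+1..n}) ({i\<in>{1..n}. y i = 1} \<union> ({1..n} - {i\<in>{1..n}. y i = 1}))"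
    by (rule bij_betw_combine[OF b1 b2]) auto
  moreover have "{i\<in>{1..n}. y i = 1} \<union> ({1..n} - {i\<in>{1..n}. y i = 1}) = {1..n}" by auto
  ultimately have "bij_betw \<pi> {1..n} {1..n}" using un by simp
  then have perm: "\<pi> permutes {1..n}"
    by (rule bij_imp_permutes) (use \<open>N \<le> n\<close> in \<open>auto simp: \<pi>_def\<close>)
  have "{r\<in>{1..n}. y (\<pi> r) = 1} = {1..N}"
  proof (intro antisym subsetI)
    fix r assume "r \<in> {1..N}"
    then show "r \<in> {r\<in>{1..n}. y (\<pi> r) = 1}" using bij_betwE[OF b1] \<open>N \<le> n\<close> by auto
  next
    fix r assume r: "r \<in> {r\<in>{1..n}. y (\<pi> r) = 1}"
    then have "r \<notin> {N+1..n}" using bij_betwE[OF b2] by fastforce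
    then show "r \<in> {1..N}" using r by auto
  qed
  then have attained: "dcg D n \<pi> y = (\<Sum>r=1..N. D r)" using dcg_eq[OF perm] by simp
  show ?thesis
    unfolding idcg_def N_def[symmetric]
  proof (rule Max_eqI)
    show "finite ((\<lambda>\<pi>. dcg D n \<pi> y) ` {\<pi>. \<pi> permutes {1..n}})"
      by (simp add: finite_permutations)
    show "(\<Sum>r=1..N. D r) \<in> (\<lambda>\<pi>. dcg D n \<pi> y) ` {\<pi>. \<pi> permutes {1..n}}"
      using attained perm by force
    fix z assume "z \<in> (\<lambda>\<pi>. dcg D n \<pi> y) ` {\<pi>. \<pi> permutes {1..n}}"
    then obtain \<sigma> where "\<sigma> permutes {1..n}" "z = dcg D n \<sigma> y" by auto
    then show "z \<le> (\<Sum>r=1..N. D r)"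
      using sum_decreasing_le_initial[where R="{r\<in>{1..n}. y (\<sigma> r) = 1}", OF dec]
      unfolding card_eq[OF \<open>\<sigma> permutes {1..n}\<close>] dcg_eq[OF \<open>\<sigma> permutes {1..n}\<close>]
      by (simp add: subset_eq)
  qed
qed

text \<open>Wherever this is applied both boundary terms vanish: \<open>D (Suc n) = 0\<close> by the
  cutoff and \<open>b 0 = 0\<close>.\<close>

lemma summation_by_parts:
  fixes D b :: "nat \<Rightarrow> real"
  shows "(\<Sum>r=1..n. D r * (b r - b (r - 1)))
    = D (Suc n) * b n - D 1 * b 0 + (\<Sum>r=1..n. (D r - D (Suc r)) * b r)"
  by (induction n) (auto simp: algebra_simps)

text \<open>Concavity of \<open>x powr a\<close>: the graph lies below its tangent at
  \<open>y\<close>. After scaling to \<open>t = x / y\<close> it is the weighted inequality of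
  arithmetic and geometric means. The case \<open>x = 0\<close> is separate because
  \<open>exp (ln t) = t\<close> needs \<open>t > 0\<close>.\<close>

lemma powr_le_tangent:
  fixes x y a :: real
  assumes "0 \<le> x" "0 < y" "0 < a" "a \<le> 1"
  shows "x powr a \<le> y powr a + a * y powr (a - 1) * (x - y)"
proof (cases "x = 0")
  case True
  then show ?thesis using assms by (simp add: powr_diff)
next
  case False
  define t where "t = x / y"
  have t: "t > 0" "x = t * y" using False assms by (auto simp: t_def)
  \<comment> \<open>Convexity of \<open>exp\<close> between \<open>0\<close> and
    \<open>ln t\<close>, with weight \<open>a\<close> on the second point.\<close>
  have "exp ((1 - a) * 0 + a * ln t) \<le> (1 - a) * exp 0 + a * exp (ln t)"
    using convex_onD[OF exp_convex, of a 0 "ln t"] assms by simp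
  then have "t powr a \<le> 1 + a * (t - 1)"
    using t by (simp add: powr_def algebra_simps)
  then have "t powr a * y powr a \<le> (1 + a * (t - 1)) * y powr a"
    by (rule mult_right_mono) auto
  also have "\<dots> = y powr a + a * y powr (a - 1) * (x - y)"
    using assms t by (simp add: powr_diff field_simps)
  finally show ?thesis using t assms by (simp add: powr_mult)
qed

text \<open>Both bounds telescope tangent inequalities for the power \<open>1 - \<beta>\<close>,
  whose derivative is the summand up to the factor \<open>1 - \<beta>\<close>. The tangent at
  \<open>Suc m\<close> is evaluated one step to the left for the upper bound and one step to the
  right for the lower one. The two bounds differ by a constant, which is what
  \<open>idcg_converges_in_prob\<close> exploits.\<close>

lemma sum_powr_bounds:
  fixes \<beta> :: real
  assumes "0 < \<beta>" "\<beta> < 1"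
  shows "(\<Sum>r=1..m. real r powr (-\<beta>)) \<le> real m powr (1 - \<beta>) / (1 - \<beta>)"
    and "(real m powr (1 - \<beta>) - 1) / (1 - \<beta>) \<le> (\<Sum>r=1..m. real r powr (-\<beta>))"
proof -
  have up: "(1 - \<beta>) * (\<Sum>r=1..m. real r powr (-\<beta>)) \<le> real m powr (1 - \<beta>)"
  proof (induction m)
    case (Suc m)
    have "real m powr (1 - \<beta>) \<le> real (Suc m) powr (1 - \<beta>)
        + (1 - \<beta>) * real (Suc m) powr (1 - \<beta> - 1) * (real m - real (Suc m))"
      using assms by (intro powr_le_tangent) auto
    then show ?case using Suc by (simp add: algebra_simps)
  qed simp
  \<comment> \<open>The shift to \<open>Suc m\<close> makes the base case an equality; monotonicity
    of the power undoes it afterwards.\<close>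
  have low: "real (Suc m) powr (1 - \<beta>) - 1 \<le> (1 - \<beta>) * (\<Sum>r=1..m. real r powr (-\<beta>))"
  proof (induction m)
    case (Suc m)
    have "real (Suc (Suc m)) powr (1 - \<beta>) \<le> real (Suc m) powr (1 - \<beta>)
        + (1 - \<beta>) * real (Suc m) powr (1 - \<beta> - 1) * (real (Suc (Suc m)) - real (Suc m))"
      using assms by (intro powr_le_tangent) auto
    then show ?case using Suc by (simp add: algebra_simps)
  qed simp
  have "real m powr (1 - \<beta>) \<le> real (Suc m) powr (1 - \<beta>)"
    using assms by (intro powr_mono2) auto
  then show "(\<Sum>r=1..m. real r powr (-\<beta>)) \<le> real m powr (1 - \<beta>) / (1 - \<beta>)"
    "(real m powr (1 - \<beta>) - 1) / (1 - \<beta>) \<le> (\<Sum>r=1..m. real r powr (-\<beta>))"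
    using up low assms by (auto simp: field_simps)
qed

text \<open>The range starts at rank 1 because \<open>0 powr (-\<beta>) = 0\<close> makes the
  discount vanish at rank 0.\<close>

lemma cutoff_power_discount_decreasing:
  assumes "0 \<le> \<beta>" "1 \<le> r" "r \<le> s"
  shows "cutoff_power_discount \<beta> k s \<le> cutoff_power_discount \<beta> k r"
  using assms by (auto simp: cutoff_power_discount_def intro: powr_mono2')

lemma cutoff_power_discount_le: "cutoff_power_discount \<beta> k r \<le> real r powr (-\<beta>)"
  by (simp add: cutoff_power_discount_def)

lemma sum_cutoff_power_discount:
  assumes "0 \<le> k"
  shows "(\<Sum>r=1..m. cutoff_power_discount \<beta> k r) = (\<Sum>r=1..min m (nat \<lfloor>k\<rfloor>). real r powr (-\<beta>))"
proof -
  have "(\<Sum>r=1..m. cutoff_power_discount \<beta> k r) = (\<Sum>r=1..min m (nat \<lfloor>k\<rfloor>). cutoff_power_discount \<beta> k r)"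
    using assms by (intro sum.mono_neutral_right) (auto simp: cutoff_power_discount_def le_nat_iff le_floor_iff)
  also have "\<dots> = (\<Sum>r=1..min m (nat \<lfloor>k\<rfloor>). real r powr (-\<beta>))"
    using assms by (intro sum.cong) (auto simp: cutoff_power_discount_def le_nat_iff le_floor_iff)
  finally show ?thesis .
qed

text \<open>An up-set of the scores occupies the first \<open>card S\<close> ranks, so its label sum is the one of the top
  \<open>card S\<close> items; this holds however ties are broken.\<close>

lemma sum_top_labels_vs_upset:
  fixes y :: "nat \<Rightarrow> nat"
  assumes \<pi>: "\<pi> permutes {1..n}"
    and up: "\<And>r s. r \<in> {1..n} \<Longrightarrow> s \<in> {1..n} \<Longrightarrow> r \<le> s \<Longrightarrow> \<pi> s \<in> S \<Longrightarrow> \<pi> r \<in> S"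
    and bin: "\<And>i. i \<in> {1..n} \<Longrightarrow> y i \<le> 1" and "S \<subseteq> {1..n}" and "m \<le> n"
  shows "\<bar>(\<Sum>r=1..m. real (y (\<pi> r))) - (\<Sum>i\<in>S. real (y i))\<bar> \<le> \<bar>real m - real (card S)\<bar>"
proof -
  define R where "R = {r\<in>{1..n}. \<pi> r \<in> S}"
  have inj: "inj_on \<pi> A" for A using \<pi> by (rule permutes_inj_on)
  have S: "S = \<pi> ` R"
    using permutes_image_Collect[OF \<pi>, of "\<lambda>i. i \<in> S"] \<open>S \<subseteq> {1..n}\<close> by (auto simp: R_def)
  \<comment> \<open>The ranks of an up-set are closed downwards, hence form an initial
    segment.\<close>
  have R: "R = {1..card R}"
  proof (cases "R = {}")
    case False
    have "finite R" by (simp add: R_def)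
    then have "R = {1..Max R}"
    proof (intro antisym subsetI)
      fix r assume "r \<in> {1..Max R}"
      moreover have "Max R \<in> R" using \<open>finite R\<close> False by (rule Max_in)
      ultimately show "r \<in> R" using up[of r "Max R"] by (auto simp: R_def)
    qed (auto simp: R_def)
    moreover from this have "card R = Max R" using card_atLeastAtMost[of 1 "Max R"] by simp
    ultimately show ?thesis by simp
  qed simp
  have cR: "card S = card R" unfolding S by (rule card_image[OF inj])
  have "R \<subseteq> {1..n}" by (auto simp: R_def)
  then have cn: "card R \<le> n" using card_mono[of "{1..n}" R] by simp
  have eq: "(\<Sum>i\<in>S. real (y i)) = (\<Sum>r=1..card R. real (y (\<pi> r)))"
    unfolding S using R by (simp add: sum.reindex[OF inj])
  \<comment> \<open>The two label sums to compare are prefix sums along \<open>\<pi>\<close>, so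
    they differ by one block of consecutive ranks, and a block contributes at most its
    length.\<close>
  have bnd: "0 \<le> (\<Sum>r=Suc a..b. real (y (\<pi> r))) \<and> (\<Sum>r=Suc a..b. real (y (\<pi> r))) \<le> real b - real a"
    if "a \<le> b" "b \<le> n" for a b
  proof
    have "(\<Sum>r=Suc a..b. real (y (\<pi> r))) \<le> (\<Sum>r=Suc a..b. 1)"
    proof (rule sum_mono)
      fix r assume "r \<in> {Suc a..b}"
      then have "\<pi> r \<in> {1..n}" using that permutes_in_image[OF \<pi>, of r] by auto
      then show "real (y (\<pi> r)) \<le> 1" using bin by simp
    qed
    then show "(\<Sum>r=Suc a..b. real (y (\<pi> r))) \<le> real b - real a" using that by simp
  qed (simp add: sum_nonneg)
  have split: "(\<Sum>r=1..b. real (y (\<pi> r))) = (\<Sum>r=1..a. real (y (\<pi> r))) + (\<Sum>r=Suc a..b. real (y (\<pi> r)))"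
    if "a \<le> b" for a b :: nat
    using sum.ub_add_nat[of 1 a "\<lambda>r. real (y (\<pi> r))" "b - a"] that by simp
  show ?thesis
  proof (cases "m \<le> card R")
    case True
    then show ?thesis using split[of m "card R"] bnd[of m "card R"] cn unfolding eq cR by auto
  next
    case False
    then show ?thesis using split[of "card R" m] bnd[of "card R" m] \<open>m \<le> n\<close> unfolding eq cR by auto
  qed
qed

subsection \<open>Convergence in probability\<close>

text \<open>Markov's inequality together with the triangle inequality. The centre \<open>a n\<close>
  may move with \<open>n\<close>, so that random deviation and deterministic convergence are treated
  apart; \<open>eventually\<close> allows \<open>n = 0\<close> to be discarded.\<close>

lemma converges_in_prob_mean:
  fixes X :: "nat \<Rightarrow> 'w \<Rightarrow> real"
  assumes "prob_space M" and [measurable]: "\<And>n. X n \<in> borel_measurable M"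
    and int: "\<And>n. integrable M (X n)"
    and e: "eventually (\<lambda>n. (\<integral>\<omega>. \<bar>X n \<omega> - a n\<bar> \<partial>M) \<le> e n) sequentially" "e \<longlonglongrightarrow> 0" and a: "a \<longlonglongrightarrow> L"
  shows "converges_in_prob M X L"
  unfolding converges_in_prob_def
proof (intro conjI allI impI)
  interpret prob_space M by fact
  show "X n \<in> borel_measurable M" for n by measurable
  fix \<epsilon> :: real assume "\<epsilon> > 0"
  have bound: "measure M {\<omega> \<in> space M. \<bar>X n \<omega> - L\<bar> > \<epsilon>} \<le> (e n + \<bar>a n - L\<bar>) / \<epsilon>"
    if "(\<integral>\<omega>. \<bar>X n \<omega> - a n\<bar> \<partial>M) \<le> e n" for n
  proof -
    have "measure M {\<omega> \<in> space M. \<bar>X n \<omega> - L\<bar> > \<epsilon>} \<le> measure M {\<omega> \<in> space M. \<bar>X n \<omega> - L\<bar> \<ge> \<epsilon>}"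
      by (intro finite_measure_mono) auto
    also have "\<dots> \<le> (\<integral>\<omega>. \<bar>X n \<omega> - L\<bar> \<partial>M) / \<epsilon>"
      using int \<open>\<epsilon> > 0\<close> by (intro integral_Markov_inequality_measure[where A="{}"]) auto
    also have "(\<integral>\<omega>. \<bar>X n \<omega> - L\<bar> \<partial>M) \<le> (\<integral>\<omega>. \<bar>X n \<omega> - a n\<bar> + \<bar>a n - L\<bar> \<partial>M)"
      using int by (intro integral_mono) auto
    also have "\<dots> = (\<integral>\<omega>. \<bar>X n \<omega> - a n\<bar> \<partial>M) + \<bar>a n - L\<bar>"
      using int by (simp add: prob_space)
    also have "\<dots> \<le> e n + \<bar>a n - L\<bar>" using that by simp
    finally show ?thesis using \<open>\<epsilon> > 0\<close> by (simp add: divide_right_mono)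
  qed
  have "(\<lambda>n. \<bar>a n - L\<bar>) \<longlonglongrightarrow> 0" using a by (simp add: LIM_zero tendsto_rabs_zero)
  from tendsto_divide[OF tendsto_add[OF e(2) this] tendsto_const[of \<epsilon>]] \<open>\<epsilon> > 0\<close>
  have "(\<lambda>n. (e n + \<bar>a n - L\<bar>) / \<epsilon>) \<longlonglongrightarrow> 0" by simp
  then show "(\<lambda>n. measure M {\<omega> \<in> space M. \<bar>X n \<omega> - L\<bar> > \<epsilon>}) \<longlonglongrightarrow> 0"
    by (rule tendsto_sandwich[rotated 2, OF tendsto_const]) (auto intro: eventually_mono[OF e(1) bound])
qed

text \<open>Lets a deterministic sequence be one of the two arguments of
  \<open>converges_in_prob_continuous\<close>.\<close>

lemma converges_in_prob_const:
  assumes "prob_space M" "a \<longlonglongrightarrow> L"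
  shows "converges_in_prob M (\<lambda>n _. a n) L"
proof (rule converges_in_prob_mean)
  interpret prob_space M by fact
  show "integrable M (\<lambda>_. a n)" for n by simp
  show "\<forall>\<^sub>F n in sequentially. (\<integral>\<omega>. \<bar>a n - a n\<bar> \<partial>M) \<le> 0" by simp
qed (use assms in simp_all)

text \<open>A large deviation of \<open>g\<close> forces one of its arguments away from the limit
  point, and a union bound finishes. Continuity is required at the limit point only, which admits
  the ratio with a default value; measurability of the composition is therefore a separate
  hypothesis.\<close>

lemma converges_in_prob_continuous:
  assumes M: "prob_space M"
    and X: "converges_in_prob M X x" and Y: "converges_in_prob M Y y"
    and g: "isCont (\<lambda>(u, v). g u v) (x, y)"
    and meas: "\<And>n. (\<lambda>\<omega>. g (X n \<omega>) (Y n \<omega>)) \<in> borel_measurable M"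
  shows "converges_in_prob M (\<lambda>n \<omega>. g (X n \<omega>) (Y n \<omega>)) (g x y)"
  unfolding converges_in_prob_def
proof (intro conjI allI impI meas)
  interpret prob_space M by fact
  have [measurable]: "X n \<in> borel_measurable M" "Y n \<in> borel_measurable M" for n
    using X Y by (auto simp: converges_in_prob_def)
  fix \<epsilon> :: real assume "\<epsilon> > 0"
  from g this obtain d where d: "d > 0"
    "\<And>u v. dist (u, v) (x, y) < d \<Longrightarrow> dist (g u v) (g x y) < \<epsilon>"
    unfolding continuous_at_eps_delta by fastforce
  \<comment> \<open>Two coordinate errors of at most \<open>d / 3\<close> keep the pair at distance
    at most \<open>2 * d / 3\<close>, strictly below \<open>d\<close>.\<close>
  define e where "e = d / 3"
  then have e: "e > 0" "2 * e < d" using d(1) by auto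
  have bound: "measure M {\<omega> \<in> space M. \<bar>g (X n \<omega>) (Y n \<omega>) - g x y\<bar> > \<epsilon>}
    \<le> measure M {\<omega> \<in> space M. \<bar>X n \<omega> - x\<bar> > e} + measure M {\<omega> \<in> space M. \<bar>Y n \<omega> - y\<bar> > e}" for n
  proof -
    have "measure M {\<omega> \<in> space M. \<bar>g (X n \<omega>) (Y n \<omega>) - g x y\<bar> > \<epsilon>}
      \<le> measure M ({\<omega> \<in> space M. \<bar>X n \<omega> - x\<bar> > e} \<union> {\<omega> \<in> space M. \<bar>Y n \<omega> - y\<bar> > e})"
    proof (intro finite_measure_mono subsetI)
      fix \<omega> assume \<omega>: "\<omega> \<in> {\<omega> \<in> space M. \<bar>g (X n \<omega>) (Y n \<omega>) - g x y\<bar> > \<epsilon>}"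
      then have "\<not> dist (X n \<omega>, Y n \<omega>) (x, y) < d" using d(2) by (fastforce simp: dist_real_def)
      moreover have "dist (X n \<omega>, Y n \<omega>) (x, y) \<le> \<bar>X n \<omega> - x\<bar> + \<bar>Y n \<omega> - y\<bar>"
        unfolding dist_Pair_Pair dist_real_def by (rule sqrt_sum_squares_le_sum) auto
      ultimately have "\<bar>X n \<omega> - x\<bar> > e \<or> \<bar>Y n \<omega> - y\<bar> > e" using e by linarith
      then show "\<omega> \<in> {\<omega> \<in> space M. \<bar>X n \<omega> - x\<bar> > e} \<union> {\<omega> \<in> space M. \<bar>Y n \<omega> - y\<bar> > e}"
        using \<omega> by auto
    qed auto
    also have "\<dots> \<le> measure M {\<omega> \<in> space M. \<bar>X n \<omega> - x\<bar> > e} + measure M {\<omega> \<in> space M. \<bar>Y n \<omega> - y\<bar> > e}"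
      by (intro measure_subadditive) auto
    finally show ?thesis .
  qed
  have "(\<lambda>n. measure M {\<omega> \<in> space M. \<bar>X n \<omega> - x\<bar> > e}
     + measure M {\<omega> \<in> space M. \<bar>Y n \<omega> - y\<bar> > e}) \<longlonglongrightarrow> 0"
    using X Y e(1) by (intro tendsto_add_zero) (auto simp: converges_in_prob_def)
  then show "(\<lambda>n. measure M {\<omega> \<in> space M. \<bar>g (X n \<omega>) (Y n \<omega>) - g x y\<bar> > \<epsilon>}) \<longlonglongrightarrow> 0"
    by (rule tendsto_sandwich[rotated 2, OF tendsto_const]) (simp_all add: bound)
qed

lemma converges_in_prob_cong:
  assumes "\<And>n \<omega>. \<omega> \<in> space M \<Longrightarrow> X n \<omega> = Y n \<omega>"
  shows "converges_in_prob M X L \<longleftrightarrow> converges_in_prob M Y L"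
proof -
  have "X n \<in> borel_measurable M \<longleftrightarrow> Y n \<in> borel_measurable M" for n
    using assms by (rule measurable_cong)
  moreover have "{\<omega> \<in> space M. \<bar>X n \<omega> - L\<bar> > \<epsilon>} = {\<omega> \<in> space M. \<bar>Y n \<omega> - L\<bar> > \<epsilon>}" for n \<epsilon>
    using assms by auto
  ultimately show ?thesis by (simp add: converges_in_prob_def)
qed

text \<open>Near a point whose second coordinate is nonzero the default branch is never taken, so
  the function agrees locally with the quotient. This absorbs the convention for a vanishing ideal
  DCG.\<close>

lemma isCont_ratio_default:
  fixes a b d :: real
  assumes "b \<noteq> 0"
  shows "isCont (\<lambda>(u, v). if v = 0 then d else u / v) (a, b)"
proof -
  have "((\<lambda>z. fst z / snd z) \<longlongrightarrow> fst (a, b) / snd (a, b)) (at (a, b))"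
    using assms by (intro tendsto_divide tendsto_fst tendsto_snd tendsto_ident_at) simp
  moreover have "((\<lambda>z. snd z) \<longlongrightarrow> snd (a, b)) (at (a, b))"
    by (intro tendsto_snd tendsto_ident_at)
  then have "\<forall>\<^sub>F z in at (a, b). snd z \<noteq> 0"
    using assms by (intro tendsto_imp_eventually_ne) auto
  then have "\<forall>\<^sub>F z in at (a, b). fst z / snd z = (case z of (u, v) \<Rightarrow> if v = 0 then d else u / v)"
    by eventually_elim (simp add: case_prod_unfold)
  ultimately have "((\<lambda>(u, v). if v = 0 then d else u / v) \<longlongrightarrow> fst (a, b) / snd (a, b)) (at (a, b))"
    by (rule Lim_transform_eventually)
  then show ?thesis using assms by (simp add: isCont_def)
qed

subsection \<open>Counting deviations, scores and conditional probabilities\<close>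

text \<open>Nonnegativity of the variance of \<open>\<bar>X\<bar>\<close>.\<close>

lemma (in prob_space) expectation_abs_le_sqrt:
  fixes X :: "'a \<Rightarrow> real"
  assumes [measurable]: "X \<in> borel_measurable M" and "integrable M (\<lambda>\<omega>. (X \<omega>)\<^sup>2)"
  shows "expectation (\<lambda>\<omega>. \<bar>X \<omega>\<bar>) \<le> sqrt (expectation (\<lambda>\<omega>. (X \<omega>)\<^sup>2))"
proof -
  have "integrable M X" using assms by (rule square_integrable_imp_integrable)
  then have "variance (\<lambda>\<omega>. \<bar>X \<omega>\<bar>) = expectation (\<lambda>\<omega>. (X \<omega>)\<^sup>2) - (expectation (\<lambda>\<omega>. \<bar>X \<omega>\<bar>))\<^sup>2"
    using assms by (subst variance_eq) auto
  then show ?thesis using variance_positive[of "\<lambda>\<omega>. \<bar>X \<omega>\<bar>"] by (intro real_le_rsqrt) simp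
qed

text \<open>The cross terms of the squared deviation vanish by independence, leaving the variance of
  a binomial count. Keeping the factor \<open>measure P B\<close> matters: for a set of mass
  \<open>r / n\<close> it gives \<open>sqrt r\<close> in place of \<open>sqrt n\<close>, and
  \<open>sqrt n\<close> would not be negligible against \<open>n powr (1 - \<beta>)\<close> when
  \<open>\<beta> \<ge> 1/2\<close>.\<close>

lemma (in prob_space) expectation_abs_count_deviation:
  assumes ind: "indep_vars (\<lambda>_. N) Z I" and "finite I"
    and distr: "\<And>i. i \<in> I \<Longrightarrow> distr M N (Z i) = P"
    and B[measurable]: "B \<in> sets N"
  shows "expectation (\<lambda>\<omega>. \<bar>(\<Sum>i\<in>I. indicator B (Z i \<omega>)) - real (card I) * measure P B\<bar>)
    \<le> sqrt (real (card I) * measure P B)"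
proof -
  define q where "q = measure P B"
  define Y where "Y i \<omega> = indicator B (Z i \<omega>) - q" for i \<omega>
  have Z[measurable]: "Z i \<in> measurable M N" if "i \<in> I" for i
    using ind that by (auto simp: indep_vars_def)
  have Ym[measurable]: "Y i \<in> borel_measurable M" if "i \<in> I" for i
    unfolding Y_def using Z[OF that] by measurable
  have ind_mean: "expectation (\<lambda>\<omega>. indicator B (Z i \<omega>)) = q"
    and ind_int: "integrable M (\<lambda>\<omega>. indicator B (Z i \<omega>) :: real)" if "i \<in> I" for i
  proof -
    note [measurable] = Z[OF that]
    show "integrable M (\<lambda>\<omega>. indicator B (Z i \<omega>) :: real)"
      by (intro integrable_const_bound[where B=1]) (auto simp: indicator_def)
    have "expectation (\<lambda>\<omega>. indicator B (Z i \<omega>)) = (\<integral>z. (indicator B z :: real) \<partial>distr M N (Z i))"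
      by (rule integral_distr[symmetric]) auto
    then show "expectation (\<lambda>\<omega>. indicator B (Z i \<omega>)) = q"
      using sets.sets_into_space[OF B] by (simp add: distr[OF that] q_def Int_absorb2 flip: distr[OF that])
  qed
  have Y_mean: "expectation (Y i) = 0" and Y_int: "integrable M (Y i)" if "i \<in> I" for i
    using ind_mean[OF that] ind_int[OF that] by (auto simp: Y_def[abs_def] prob_space)
  have q: "0 \<le> q" by (simp add: q_def)
  have YY_int: "integrable M (\<lambda>\<omega>. Y i \<omega> * Y j \<omega>)" if "i \<in> I" "j \<in> I" for i j
  proof (rule integrable_const_bound[where B="(1 + q) * (1 + q)"])
    have "\<bar>Y k \<omega>\<bar> \<le> 1 + q" for k \<omega> using q by (auto simp: Y_def indicator_def)
    then show "AE \<omega> in M. norm (Y i \<omega> * Y j \<omega>) \<le> (1 + q) * (1 + q)"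
      using q by (auto simp: abs_mult intro!: mult_mono)
  qed (use that Ym in measurable)
  have Y_indep: "expectation (\<lambda>\<omega>. Y i \<omega> * Y j \<omega>) = 0" if "i \<in> I" "j \<in> I" "i \<noteq> j" for i j
  proof -
    have "indep_vars (\<lambda>_. borel) Y I"
      unfolding Y_def[abs_def] by (rule indep_vars_compose2[OF ind, where Y="\<lambda>_ z. indicator B z - q"]) simp
    \<comment> \<open>The sum over the singleton \<open>{j}\<close> turns
      \<open>indep_vars_sum\<close> into pairwise independence.\<close>
    then have "indep_var borel (Y i) borel (Y j)"
      using indep_vars_sum[of "{j}" i Y] that by (simp add: indep_vars_subset)
    then show ?thesis
      using that by (simp add: indep_var_lebesgue_integral Y_int Y_mean)
  qed
  have Y_sq: "expectation (\<lambda>\<omega>. Y i \<omega> * Y i \<omega>) \<le> q" if "i \<in> I" for i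
  proof -
    \<comment> \<open>An indicator equals its square, so the squared centred indicator is affine in
      it; its mean is \<open>q - q\<^sup>2\<close>.\<close>
    have "(\<lambda>\<omega>. Y i \<omega> * Y i \<omega>) = (\<lambda>\<omega>. (1 - 2 * q) * indicator B (Z i \<omega>) + q\<^sup>2)"
      by (auto simp: Y_def indicator_def power2_eq_square algebra_simps)
    then have "expectation (\<lambda>\<omega>. Y i \<omega> * Y i \<omega>) = (1 - 2 * q) * q + q\<^sup>2"
      using ind_int[OF that] ind_mean[OF that] by (simp add: prob_space)
    then show ?thesis using zero_le_square[of q] by (simp add: power2_eq_square algebra_simps del: zero_le_square)
  qed
  have dev: "(\<Sum>i\<in>I. indicator B (Z i \<omega>)) - real (card I) * q = (\<Sum>i\<in>I. Y i \<omega>)" for \<omega>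
    by (simp add: Y_def sum_subtractf)
  have sq: "(\<Sum>i\<in>I. Y i \<omega>)\<^sup>2 = (\<Sum>i\<in>I. \<Sum>j\<in>I. Y i \<omega> * Y j \<omega>)" for \<omega>
    by (simp add: power2_eq_square sum_product)
  have "expectation (\<lambda>\<omega>. (\<Sum>i\<in>I. Y i \<omega>)\<^sup>2) = (\<Sum>i\<in>I. \<Sum>j\<in>I. expectation (\<lambda>\<omega>. Y i \<omega> * Y j \<omega>))"
    unfolding sq using YY_int by (simp add: Bochner_Integration.integral_sum integrable_sum)
  also have "\<dots> = (\<Sum>i\<in>I. \<Sum>j\<in>I. if j = i then expectation (\<lambda>\<omega>. Y i \<omega> * Y i \<omega>) else 0)"
    using Y_indep by (intro sum.cong refl) auto
  also have "\<dots> \<le> (\<Sum>i\<in>I. q)"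
    using Y_sq \<open>finite I\<close> by (intro sum_mono) (simp add: sum.delta)
  finally have var: "expectation (\<lambda>\<omega>. (\<Sum>i\<in>I. Y i \<omega>)\<^sup>2) \<le> real (card I) * q" by simp
  have "expectation (\<lambda>\<omega>. \<bar>\<Sum>i\<in>I. Y i \<omega>\<bar>) \<le> sqrt (expectation (\<lambda>\<omega>. (\<Sum>i\<in>I. Y i \<omega>)\<^sup>2))"
    using Ym YY_int by (intro expectation_abs_le_sqrt borel_measurable_sum) (auto simp: sq)
  also have "\<dots> \<le> sqrt (real (card I) * q)" using var by simp
  finally show ?thesis by (simp add: dev flip: q_def)
qed

text \<open>The probability integral transform. The cdf is continuous but may have flat pieces, so
  it is not inverted; the mass of \<open>{x. cdf M x \<le> t}\<close> is squeezed between levels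
  that the cdf attains.\<close>

lemma (in real_distribution) distr_cdf_atomless:
  assumes atomless: "\<And>a. measure M {a} = 0"
  shows "distr M borel (cdf M) = uniform_measure lborel {0..1}"
proof (rule cdf_unique)
  have cont: "isCont (cdf M) x" for x using atomless by (simp add: isCont_cdf)
  then have contU: "continuous_on A (cdf M)" for A by (simp add: continuous_at_imp_continuous_on)
  have [measurable]: "cdf M \<in> borel_measurable borel"
    by (rule borel_measurable_continuous_onI[OF contU])
  have [measurable]: "cdf M \<in> borel_measurable M" by simp
  show "real_distribution (distr M borel (cdf M))" by (simp add: real_distribution_distr)
  have "prob_space (uniform_measure lborel {0..1::real})"
    by (rule prob_space_uniform_measure) auto
  then show "real_distribution (uniform_measure lborel {0..1})"
    by (simp add: real_distribution_def real_distribution_axioms_def)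
  show "cdf (distr M borel (cdf M)) = cdf (uniform_measure lborel {0..1})"
  proof
    fix s :: real
    \<comment> \<open>The limits at both infinities and the intermediate value theorem give every
      level strictly between 0 and 1.\<close>
    have exists_level: "\<exists>a. cdf M a = t" if "0 < t" "t < 1" for t
    proof -
      have "eventually (\<lambda>x. cdf M x < t) at_bot"
        using cdf_lim_at_bot that(1) by (rule order_tendstoD(2))
      then obtain l where l: "cdf M l < t" by (auto simp: eventually_at_bot_linorder)
      have "eventually (\<lambda>x. t < cdf M x) at_top"
        using cdf_lim_at_top_prob that(2) by (rule order_tendstoD(1))
      then obtain u where u: "t < cdf M u" by (auto simp: eventually_at_top_linorder)
      have "l \<le> u" using cdf_nondecreasing[of u l] l u by linarith
      then show ?thesis using IVT'[of "cdf M" l t u] l u contU by auto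
    qed
    define F where "F t = measure M {x. cdf M x \<le> t}" for t
    have F_ge: "t \<le> F t" if "0 < t" "t < 1" for t
    proof -
      obtain a where a: "cdf M a = t" using exists_level[OF \<open>0 < t\<close> \<open>t < 1\<close>] by auto
      have "measure M {..a} \<le> F t"
        unfolding F_def using a cdf_nondecreasing by (intro finite_measure_mono) auto
      then show ?thesis using a by (simp add: cdf_def)
    qed
    \<comment> \<open>A strictly larger level \<open>u\<close> is used because the cdf may be flat
      at height \<open>t\<close>: points with cdf at most \<open>t\<close> lie to the left of any
      point with cdf \<open>u\<close>. Letting \<open>u\<close> decrease to \<open>t\<close>
      recovers the sharp bound.\<close>
    have F_le: "F t \<le> u" if "t < u" "0 < u" "u < 1" for t u
    proof -
      obtain a where a: "cdf M a = u" using exists_level[OF \<open>0 < u\<close> \<open>u < 1\<close>] by auto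
      have "x \<le> a" if "cdf M x \<le> t" for x
        using cdf_nondecreasing[of a x] that a \<open>t < u\<close> by linarith
      then have "F t \<le> measure M {..a}" unfolding F_def by (intro finite_measure_mono) auto
      then show ?thesis using a by (simp add: cdf_def)
    qed
    have F1: "F t = 1" if "1 \<le> t" for t
      unfolding F_def using that cdf_bounded_prob order_trans
      by (subst prob_space[symmetric]) (auto intro!: arg_cong[where f="measure M"])
    have F0: "F t = 0" if "t \<le> 0" for t
    proof -
      have "F t \<le> u" if "0 < u" "u < 1" for u using F_le[of t u] that \<open>t \<le> 0\<close> by auto
      then have "F t \<le> 0" by (intro dense_le_bounded[of "0::real" 1 "F t"] dense_ge_bounded[of 0 1]) auto
      then show ?thesis by (simp add: F_def measure_le_0_iff)
    qed
    have "F s = (if s \<le> 0 then 0 else if 1 \<le> s then 1 else s)"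
    proof -
      have "F s \<le> s" if "0 < s" "s < 1"
        using that F_le[of s] by (intro dense_ge_bounded[of s 1]) auto
      then show ?thesis using F0 F1 F_ge[of s] by force
    qed
    moreover have "cdf (distr M borel (cdf M)) s = F s"
      unfolding cdf_def[of "distr M borel (cdf M)"] F_def
      by (subst measure_distr) (auto intro!: arg_cong[where f="measure M"])
    moreover have "cdf (uniform_measure lborel {0..1}) s = (if s \<le> 0 then 0 else if 1 \<le> s then 1 else s)"
    proof -
      have "{0..1} \<inter> {..s} = {0..min 1 s}" by auto
      then show ?thesis by (simp add: cdf_def measure_uniform_measure)
    qed
    ultimately show "cdf (distr M borel (cdf M)) s = cdf (uniform_measure lborel {0..1}) s" by simp
  qed
qed

text \<open>The defining property of conditional expectation, tested against
  \<open>\<phi> (T z)\<close>, which is measurable for the sigma-algebra of \<open>T\<close>.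
  Integrability of this test function suffices, so the unbounded weight
  \<open>(1 - s) powr (-\<beta>)\<close> is allowed. Measurability is imposed on \<open>g\<close>
  composed with \<open>T\<close>, since \<open>ybar\<close> is controlled on the unit interval
  alone.\<close>

lemma cond_prob_version_expectation:
  fixes T :: "'a \<Rightarrow> real"
  assumes "prob_space M" and A[measurable]: "A \<in> sets M" and T[measurable]: "T \<in> borel_measurable M"
    and ver: "cond_prob_version M A T g"
    and \<phi>[measurable]: "\<phi> \<in> borel_measurable borel" and int: "integrable M (\<lambda>z. \<phi> (T z))"
    and g: "(\<lambda>z. g (T z)) \<in> borel_measurable M"
  shows "(\<integral>z. indicator A z * \<phi> (T z) \<partial>M) = (\<integral>z. g (T z) * \<phi> (T z) \<partial>M)"
proof -
  interpret prob_space M by fact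
  let ?F = "vimage_algebra (space M) T borel"
  have sub: "subalgebra M ?F"
    unfolding subalgebra_def
    using measurable_sets[OF T] by (auto simp: sets_vimage_algebra2)
  have fm: "finite_measure (restr_to_subalg M ?F)"
    using finite_measure_restr_to_subalg[OF sub] by simp
  interpret sigma_finite_subalgebra M ?F
    by (rule sigma_finite_subalgebra.intro[OF sub]) (rule finite_measure.axioms(1)[OF fm])
  have TF: "T \<in> measurable ?F borel" by (rule measurable_vimage_algebra1) auto
  have "(\<integral>z. \<phi> (T z) * indicator A z \<partial>M) = (\<integral>z. \<phi> (T z) * real_cond_exp M ?F (indicator A) z \<partial>M)"
    using integrable_mult_indicator[OF A int] TF
    by (intro real_cond_exp_intg(2)[symmetric]) (auto simp: mult.commute)
  also have "\<dots> = (\<integral>z. g (T z) * \<phi> (T z) \<partial>M)"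
    using ver g unfolding cond_prob_version_def by (intro integral_cong_AE) auto
  finally show ?thesis by (simp add: mult.commute)
qed

text \<open>The increment at \<open>r\<close> is the mass of the part of \<open>A\<close> where
  \<open>\<lceil>n * V\<rceil> = r\<close>, so the sum is the integral over \<open>A\<close> of the
  discount at rank \<open>\<lceil>n * V\<rceil>\<close>. After scaling, the discount at rank
  \<open>m\<close> is \<open>(m / n) powr (-\<beta>)\<close> up to the cutoff at \<open>c\<close>.
  The integrands converge away from \<open>V = c\<close>, where the limit jumps, and
  \<open>V powr (-\<beta>)\<close> dominates them.\<close>

lemma scaled_discount_increments_tendsto:
  fixes V :: "'a \<Rightarrow> real" and \<beta> c :: real
  assumes "prob_space P" and A[measurable]: "A \<in> sets P" and V[measurable]: "V \<in> borel_measurable P"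
    and V_bounds: "\<And>z. z \<in> space P \<Longrightarrow> 0 \<le> V z \<and> V z \<le> 1"
    and "0 < \<beta>" "0 < c"
    and int: "integrable P (\<lambda>z. V z powr (-\<beta>))" and no_atom: "AE z in P. V z \<noteq> c"
  shows "(\<lambda>n. real n powr \<beta> * (\<Sum>r=1..n. cutoff_power_discount \<beta> (c * real n) r *
            (measure P {z\<in>A. V z \<le> real r / real n} - measure P {z\<in>A. V z \<le> real (r - 1) / real n})))
        \<longlonglongrightarrow> (\<integral>z. indicator A z * (if V z \<le> c then V z powr (-\<beta>) else 0) \<partial>P)"
proof -
  interpret prob_space P by fact
  let ?D = "\<lambda>n. cutoff_power_discount \<beta> (c * real n)"
  define h where "h n z = indicator A z * (real n powr \<beta> * ?D n (nat \<lceil>real n * V z\<rceil>))" for n z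
  have A_space: "z \<in> space P" if "z \<in> A" for z using sets.sets_into_space[OF A] that by auto
  have Gm[measurable]: "{z\<in>A. V z \<le> t} \<in> sets P" for t
  proof -
    have "{z\<in>A. V z \<le> t} = A \<inter> {z\<in>space P. V z \<le> t}" using A_space by auto
    then show ?thesis by simp
  qed
  have hm[measurable]: "h n \<in> borel_measurable P" for n
    unfolding h_def[abs_def] cutoff_power_discount_def by measurable
  have h_eq: "real n powr \<beta> * (\<Sum>r=1..n. ?D n r *
            (measure P {z\<in>A. V z \<le> real r / real n} - measure P {z\<in>A. V z \<le> real (r - 1) / real n}))
      = (\<integral>z. h n z \<partial>P)" if "n > 0" for n
  proof -
    define B where "B r = {z\<in>A. V z \<le> real r / real n} - {z\<in>A. V z \<le> real (r - 1) / real n}" for r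
    have Bm[measurable]: "B r \<in> sets P" for r unfolding B_def by measurable
    have B_iff: "z \<in> B r \<longleftrightarrow> z \<in> A \<and> nat \<lceil>real n * V z\<rceil> = r" if "r \<in> {1..n}" for z r
    proof -
      have "z \<in> B r \<longleftrightarrow> z \<in> A \<and> real n * V z \<le> real r \<and> real r - 1 < real n * V z"
        using that \<open>n > 0\<close> by (auto simp: B_def field_simps not_le of_nat_diff)
      also have "\<dots> \<longleftrightarrow> z \<in> A \<and> \<lceil>real n * V z\<rceil> = int r" by (simp add: ceiling_eq_iff conj_commute)
      also have "\<dots> \<longleftrightarrow> z \<in> A \<and> nat \<lceil>real n * V z\<rceil> = r"
      proof -
        \<comment> \<open>Valid because \<open>r \<ge> 1\<close>: \<open>nat\<close> merges integers
          only at the value 0.\<close>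
        have "k = int r \<longleftrightarrow> nat k = r" for k using that by auto
        then show ?thesis by blast
      qed
      finally show ?thesis .
    qed
    have diff_eq: "measure P {z\<in>A. V z \<le> real r / real n} - measure P {z\<in>A. V z \<le> real (r - 1) / real n}
        = measure P (B r)" for r
      unfolding B_def using \<open>n > 0\<close>
      by (subst finite_measure_Diff) (auto simp: field_simps elim!: order_trans)
    have "real n powr \<beta> * (\<Sum>r=1..n. ?D n r *
            (measure P {z\<in>A. V z \<le> real r / real n} - measure P {z\<in>A. V z \<le> real (r - 1) / real n}))
      = (\<integral>z. real n powr \<beta> * (\<Sum>r=1..n. ?D n r * indicator (B r) z) \<partial>P)"
      unfolding diff_eq
    proof (subst integral_mult_right_zero, subst Bochner_Integration.integral_sum)
      show "integrable P (\<lambda>z. ?D n r * indicator (B r) z)" for r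
        by (intro integrable_mult_right integrable_real_indicator) (auto simp: less_top[symmetric])
    qed simp
    also have "\<dots> = (\<integral>z. h n z \<partial>P)"
    proof (intro Bochner_Integration.integral_cong refl)
      fix z assume z: "z \<in> space P"
      let ?m = "nat \<lceil>real n * V z\<rceil>"
      have m: "?m \<le> n"
        using V_bounds[OF z] \<open>n > 0\<close> by (simp add: nat_le_iff ceiling_le_iff mult_left_le)
      have "(\<Sum>r=1..n. ?D n r * indicator (B r) z) = (\<Sum>r=1..n. if r = ?m then indicator A z * ?D n ?m else 0)"
        by (intro sum.cong refl) (auto simp: B_iff indicator_def)
      also have "\<dots> = indicator A z * ?D n ?m"
      proof (cases "?m = 0")
        \<comment> \<open>Rank 0 is met by no summand; the integrand agrees because
          \<open>0 powr (-\<beta>) = 0\<close>.\<close>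
        case True
        then have "?D n ?m = 0" by (simp add: cutoff_power_discount_def)
        then show ?thesis by simp
      next
        case False
        then have "1 \<le> ?m" by (metis less_one not_le)
        then have "?m \<in> {1..n}" using m unfolding atLeastAtMost_iff by blast
        then show ?thesis by (simp only: sum.delta finite_atLeastAtMost if_True)
      qed
      finally show "real n powr \<beta> * (\<Sum>r=1..n. ?D n r * indicator (B r) z) = h n z"
        by (simp add: h_def)
    qed
    finally show ?thesis .
  qed
  have scale: "real n powr \<beta> * ?D n m = (if real m \<le> c * real n then (real m / real n) powr (-\<beta>) else 0)"
    if "n > 0" for n m
    using that by (simp add: cutoff_power_discount_def powr_divide powr_minus field_simps)
  have "(\<lambda>n. \<integral>z. h n z \<partial>P) \<longlonglongrightarrow> (\<integral>z. indicator A z * (if V z \<le> c then V z powr (-\<beta>) else 0) \<partial>P)"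
  proof (rule integral_dominated_convergence[where w="\<lambda>z. V z powr (-\<beta>)"])
    show "AE z in P. (\<lambda>n. h n z) \<longlonglongrightarrow> indicator A z * (if V z \<le> c then V z powr (-\<beta>) else 0)"
      using no_atom AE_space
    proof eventually_elim
      case (elim z)
      let ?m = "\<lambda>n. nat \<lceil>real n * V z\<rceil>"
      \<comment> \<open>At \<open>V z = 0\<close> both integrand and limit are 0, again by the value
        of \<open>powr\<close> at 0; the point \<open>V z = c\<close> is excluded by
        \<open>no_atom\<close>.\<close>
      consider "V z = 0" | "0 < V z" "V z < c" | "0 < V z" "V z > c"
        using elim(1) V_bounds[OF elim(2)] by linarith
      then show ?case
      proof cases
        case 1
        then show ?thesis using \<open>0 < c\<close> by (simp add: h_def cutoff_power_discount_def)
      next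
        case 2
        have conv: "(\<lambda>n. real (?m n) / real n) \<longlonglongrightarrow> V z"
        proof (rule tendsto_sandwich)
          show "\<forall>\<^sub>F n in sequentially. V z \<le> real (?m n) / real n"
            using eventually_gt_at_top[of 0]
          proof eventually_elim
            case (elim n)
            have "real n * V z \<le> real (?m n)" by (rule of_nat_ceiling)
            then show ?case using elim by (simp add: field_simps)
          qed
          show "\<forall>\<^sub>F n in sequentially. real (?m n) / real n \<le> V z + 1 / real n"
            using eventually_gt_at_top[of 0]
          proof eventually_elim
            case (elim n)
            have "real (?m n) \<le> real n * V z + 1"
              using 2 of_int_ceiling_le_add_one[of "real n * V z"] by simp
            then show ?case using elim by (simp add: field_simps)
          qed
          show "(\<lambda>n. V z + 1 / real n) \<longlonglongrightarrow> V z"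
            using tendsto_add[OF tendsto_const[of "V z"] lim_1_over_n] by simp
        qed simp
        then have "(\<lambda>n. (real (?m n) / real n) powr (-\<beta>)) \<longlonglongrightarrow> V z powr (-\<beta>)"
          using 2 by (intro tendsto_intros) auto
        moreover have "eventually (\<lambda>n. real (?m n) / real n < c) sequentially"
          using conv 2(2) by (rule order_tendstoD(2))
        then have "eventually (\<lambda>n. (real (?m n) / real n) powr (-\<beta>) = real n powr \<beta> * ?D n (?m n)) sequentially"
          using eventually_gt_at_top[of 0] by eventually_elim (auto simp: scale field_simps)
        ultimately have "(\<lambda>n. real n powr \<beta> * ?D n (?m n)) \<longlonglongrightarrow> V z powr (-\<beta>)"
          by (rule Lim_transform_eventually)
        then show ?thesis unfolding h_def using 2 by (intro tendsto_intros) auto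
      next
        case 3
        have "real (?m n) > c * real n" if "n > 0" for n
        proof -
          have "c * real n < V z * real n" using 3 that by simp
          also have "\<dots> \<le> real (?m n)" using of_nat_ceiling[of "real n * V z"] by (simp add: mult.commute)
          finally show ?thesis .
        qed
        \<comment> \<open>For \<open>n = 0\<close> the cutoff condition can hold, but the rank is
          then 0 and its discount is 0.\<close>
        then have "real (?m n) \<le> c * real n \<Longrightarrow> n = 0" for n
          using not_le by blast
        then have "?D n (?m n) = 0" for n
          unfolding cutoff_power_discount_def by fastforce
        then have "h n z = 0" for n by (simp add: h_def)
        then show ?thesis using 3 by simp
      qed
    qed
    show "AE z in P. norm (h n z) \<le> V z powr (-\<beta>)" for n
    proof (rule AE_I2)
      fix z assume z: "z \<in> space P"
      let ?m = "nat \<lceil>real n * V z\<rceil>"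
      show "norm (h n z) \<le> V z powr (-\<beta>)"
      proof (cases "n = 0 \<or> V z = 0")
        case True
        then show ?thesis by (auto simp: h_def cutoff_power_discount_def)
      next
        case False
        then have n: "n > 0" and v: "V z > 0" using V_bounds[OF z] by auto
        \<comment> \<open>Rounding up can only increase the argument of a decreasing power; this
          gives a dominating function independent of \<open>n\<close>.\<close>
        have "real n * V z \<le> real ?m" by (rule of_nat_ceiling)
        then have "V z \<le> real ?m / real n" using n by (simp add: field_simps)
        then have "(real ?m / real n) powr (-\<beta>) \<le> V z powr (-\<beta>)"
          using v \<open>0 < \<beta>\<close> by (intro powr_mono2') auto
        then show ?thesis unfolding h_def scale[OF n] by (auto simp: indicator_def)
      qed
    qed
  qed (use int in measurable)
  moreover have "eventually (\<lambda>n. (\<integral>z. h n z \<partial>P) = real n powr \<beta> * (\<Sum>r=1..n. ?D n r *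
      (measure P {z\<in>A. V z \<le> real r / real n} - measure P {z\<in>A. V z \<le> real (r - 1) / real n}))) sequentially"
    using eventually_gt_at_top[of 0] by eventually_elim (rule h_eq[symmetric])
  ultimately show ?thesis by (rule Lim_transform_eventually)
qed

text \<open>Integrability of \<open>x powr (-\<beta>)\<close> near 0, moved from Lebesgue measure to
  \<open>lborel\<close> and reflected by \<open>u \<mapsto> 1 - u\<close>.\<close>

lemma set_integrable_powr_unit_interval:
  fixes \<beta> :: real
  assumes "\<beta> < 1"
  shows "set_integrable lborel {0..1} (\<lambda>u. (1 - u) powr (-\<beta>))"
proof -
  have "(\<lambda>x::real. x powr (-\<beta>)) absolutely_integrable_on {0..1}"
    using assms by (intro nonnegative_absolutely_integrable_1 integrable_on_powr_from_0) auto
  then have "integrable lborel (\<lambda>x. indicator {0..1} x * x powr (-\<beta>))"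
    unfolding set_integrable_def by (subst (asm) integrable_completion) auto
  then have "integrable lborel (\<lambda>u. indicator {0..1} (1 + (-1) * u) * (1 + (-1) * u) powr (-\<beta>))"
    by (intro lborel_integrable_real_affine[where t=1 and c="-1"]) auto
  moreover have "indicator {0..1} (1 + (-1) * u) = (indicator {0..1} u :: real)" for u :: real
    by (auto simp: indicator_def)
  ultimately show ?thesis by (simp add: set_integrable_def)
qed

lemma uniform_unit_interval_eq_density:
  "uniform_measure lborel {0..1::real} = density lborel (\<lambda>u. ennreal (indicator {0..1} u))"
  unfolding uniform_measure_def by (intro arg_cong2[where f=density]) (auto simp: fun_eq_iff indicator_def)

lemma floor_fraction_tendsto:
  assumes "0 \<le> c"
  shows "(\<lambda>n. real (nat \<lfloor>c * real n\<rfloor>) / real n) \<longlonglongrightarrow> c"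
proof (rule tendsto_sandwich)
  show "\<forall>\<^sub>F n in sequentially. c - 1 / real n \<le> real (nat \<lfloor>c * real n\<rfloor>) / real n"
    using eventually_gt_at_top[of 0]
  proof eventually_elim
    case (elim n)
    have "c * real n - 1 \<le> real (nat \<lfloor>c * real n\<rfloor>)" by linarith
    then have "(c * real n - 1) / real n \<le> real (nat \<lfloor>c * real n\<rfloor>) / real n"
      by (rule divide_right_mono) simp
    then show ?case using elim by (simp add: diff_divide_distrib)
  qed
  show "\<forall>\<^sub>F n in sequentially. real (nat \<lfloor>c * real n\<rfloor>) / real n \<le> c"
    using eventually_gt_at_top[of 0]
  proof eventually_elim
    case (elim n)
    have "real (nat \<lfloor>c * real n\<rfloor>) \<le> c * real n" using assms by (intro of_nat_floor) simp
    then show ?case using elim by (simp add: field_simps)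
  qed
  show "(\<lambda>n. c - 1 / real n) \<longlonglongrightarrow> c"
    using tendsto_diff[OF tendsto_const[of c] lim_1_over_n] by simp
qed simp

subsection \<open>Ranked i.i.d. samples\<close>

text \<open>The label space \<open>count_space {0, 1}\<close> forces every sampled label into
  \<open>{0, 1}\<close> at each point of \<open>space M\<close>, not just almost surely.\<close>

locale iid_ranking = prob_space M for M :: "'w measure" +
  fixes MX :: "'x measure" and P :: "('x \<times> nat) measure" and Z :: "nat \<Rightarrow> 'w \<Rightarrow> 'x \<times> nat"
    and f :: "'x \<Rightarrow> real" and \<rho> :: "nat \<Rightarrow> (nat \<Rightarrow> 'x) \<Rightarrow> nat \<Rightarrow> nat"
  assumes prob_P: "prob_space P"
    and sets_P: "sets P = sets (MX \<Otimes>\<^sub>M count_space {0, 1})"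
    and indep_Z: "indep_vars (\<lambda>_. MX \<Otimes>\<^sub>M count_space {0, 1}) Z {1..}"
    and distr_Z: "\<And>i. i \<ge> 1 \<Longrightarrow> distr M (MX \<Otimes>\<^sub>M count_space {0, 1}) (Z i) = P"
    and f[measurable]: "f \<in> borel_measurable MX"
    and ranking: "ranking_rule MX f \<rho>"
    and atomless: "\<And>a. measure (distr P borel (\<lambda>z. f (fst z))) {a} = 0"
begin

sublocale P: prob_space P by (rule prob_P)

definition score :: "'x \<times> nat \<Rightarrow> real" where
  "score z = canonical (distr P MX fst) f (fst z)"

text \<open>The function \<open>G\<close> of the overview. The depth \<open>1 - score\<close> is
  small for highly ranked items.\<close>

definition positive_mass :: "real \<Rightarrow> real" where
  "positive_mass t = measure P {z \<in> space P. snd z = 1 \<and> 1 - score z \<le> t}"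

text \<open>Restricted to \<open>{1..n}\<close> so that it lies in the product space over which
  \<open>ranking_rule\<close> quantifies, and coincides with the argument built in
  \<open>ndcg\<close>.\<close>

definition items :: "nat \<Rightarrow> 'w \<Rightarrow> nat \<Rightarrow> 'x" where
  "items n \<omega> = (\<lambda>i\<in>{1..n}. fst (Z i \<omega>))"

definition ranked_label :: "nat \<Rightarrow> nat \<Rightarrow> 'w \<Rightarrow> real" where
  "ranked_label n r \<omega> = real (snd (Z (\<rho> n (items n \<omega>) r) \<omega>))"

section \<open>Measurability of samples, orderings and ranked labels\<close>

lemma space_P: "space P = space MX \<times> {0, 1}"
  using sets_eq_imp_space_eq[OF sets_P] by (simp add: space_pair_measure)

lemma measurable_fst_P[measurable]: "fst \<in> measurable P MX"
  unfolding measurable_cong_sets[OF sets_P refl] by simp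

lemma measurable_snd_P[measurable]: "snd \<in> measurable P (count_space {0, 1})"
  unfolding measurable_cong_sets[OF sets_P refl] by simp

lemma snd_eq_1_sets[measurable]: "Measurable.pred P (\<lambda>z. snd z = 1)"
proof -
  have "snd -` {1} \<inter> space P \<in> sets P" by (rule measurable_sets[OF measurable_snd_P]) auto
  moreover have "snd -` {1} \<inter> space P = {z \<in> space P. snd z = 1}" by auto
  ultimately show ?thesis by (simp add: pred_def)
qed

lemma Z_measurable: "i \<ge> 1 \<Longrightarrow> Z i \<in> measurable M (MX \<Otimes>\<^sub>M count_space {0, 1})"
  using indep_Z by (auto simp: indep_vars_def)

lemma Z_in_space: "i \<ge> 1 \<Longrightarrow> \<omega> \<in> space M \<Longrightarrow> Z i \<omega> \<in> space P"
  using measurable_space[OF Z_measurable] by (auto simp: space_P space_pair_measure)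

lemma label_cases: "i \<ge> 1 \<Longrightarrow> \<omega> \<in> space M \<Longrightarrow> snd (Z i \<omega>) \<in> {0, 1}"
  using Z_in_space[of i \<omega>] unfolding space_P by (metis SigmaE snd_conv)

lemma label_measurable: "i \<ge> 1 \<Longrightarrow> (\<lambda>\<omega>. real (snd (Z i \<omega>))) \<in> borel_measurable M"
proof -
  assume "i \<ge> 1"
  then have "(\<lambda>\<omega>. snd (Z i \<omega>)) \<in> measurable M (count_space {0, 1})"
    using measurable_compose[OF Z_measurable measurable_snd] by auto
  then show ?thesis by (rule measurable_compose) simp
qed

lemma items_measurable[measurable]: "items n \<in> measurable M (PiM {1..n} (\<lambda>_. MX))"
  unfolding items_def
proof (rule measurable_restrict)
  fix i assume "i \<in> {1..n}"
  then show "(\<lambda>\<omega>. fst (Z i \<omega>)) \<in> measurable M MX"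
    using measurable_compose[OF Z_measurable measurable_fst] by auto
qed

lemma ranking_permutes: "\<omega> \<in> space M \<Longrightarrow> \<rho> n (items n \<omega>) permutes {1..n}"
  using ranking measurable_space[OF items_measurable] by (auto simp: ranking_rule_def)

lemma ranking_sorted:
  assumes "\<omega> \<in> space M" "r \<in> {1..n}" "s \<in> {1..n}" "r \<le> s"
  shows "f (fst (Z (\<rho> n (items n \<omega>) s) \<omega>)) \<le> f (fst (Z (\<rho> n (items n \<omega>) r) \<omega>))"
proof -
  have "f (items n \<omega> (\<rho> n (items n \<omega>) s)) \<le> f (items n \<omega> (\<rho> n (items n \<omega>) r))"
    using ranking measurable_space[OF items_measurable assms(1)] assms(2-)
    unfolding ranking_rule_def by blast
  moreover have "items n \<omega> (\<rho> n (items n \<omega>) q) = fst (Z (\<rho> n (items n \<omega>) q) \<omega>)" if "q \<in> {1..n}" for q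
  proof -
    have "\<rho> n (items n \<omega>) q \<in> {1..n}"
      using permutes_in_image[OF ranking_permutes[OF assms(1)]] that by blast
    then show ?thesis unfolding items_def by (simp only: restrict_apply if_True)
  qed
  ultimately show ?thesis using assms by metis
qed

text \<open>The index of the item at rank \<open>r\<close> is random but takes finitely many values,
  so the ranked label is pieced together from the labels of fixed items.\<close>

lemma ranked_label_measurable[measurable]:
  assumes "r \<in> {1..n}"
  shows "ranked_label n r \<in> borel_measurable M"
proof -
  have "(\<lambda>\<omega>. \<rho> n (items n \<omega>) r) \<in> measurable M (count_space UNIV)"
    by (rule measurable_compose[OF items_measurable]) (use ranking assms in \<open>auto simp: ranking_rule_def\<close>)
  moreover have "\<rho> n (items n \<omega>) r \<in> {1..n}" if "\<omega> \<in> space M" for \<omega>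
    using permutes_in_image[OF ranking_permutes[OF that]] assms by blast
  ultimately have \<rho>: "(\<lambda>\<omega>. \<rho> n (items n \<omega>) r) \<in> measurable M (count_space {1..n})"
    by (auto simp: measurable_count_space_eq2_countable intro: measurable_sets)
  have "(\<lambda>\<omega>. real (snd (Z i \<omega>))) \<in> borel_measurable M" if "i \<in> {1..n}" for i
    using that by (intro label_measurable) simp
  from measurable_compose_countable'[OF this \<rho>] show ?thesis
    by (simp add: ranked_label_def[abs_def])
qed

lemma ranked_label_bounds:
  assumes "\<omega> \<in> space M" "r \<in> {1..n}"
  shows "0 \<le> ranked_label n r \<omega> \<and> ranked_label n r \<omega> \<le> 1"
proof -
  have "\<rho> n (items n \<omega>) r \<in> {1..n}"
    using permutes_in_image[OF ranking_permutes[OF assms(1)]] assms by blast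
  then show ?thesis using label_cases[of "\<rho> n (items n \<omega>) r" \<omega>] assms by (auto simp: ranked_label_def)
qed

section \<open>The canonical score and its uniform law\<close>

lemma real_distribution_score: "real_distribution (distr P borel (\<lambda>z. f (fst z)))"
  by (intro P.real_distribution_distr) measurable

text \<open>Identifies the canonical score with the cdf of \<open>f(X)\<close> evaluated at
  \<open>f(X)\<close>, so that monotonicity and the probability integral transform apply.\<close>

lemma score_eq_cdf: "score z = cdf (distr P borel (\<lambda>z. f (fst z))) (f (fst z))"
proof -
  have "score z = measure P (fst -` {x \<in> space MX. f x \<le> f (fst z)} \<inter> space P)"
    unfolding score_def canonical_def by (subst measure_distr) auto
  also have "fst -` {x \<in> space MX. f x \<le> f (fst z)} \<inter> space P
      = (\<lambda>z. f (fst z)) -` {..f (fst z)} \<inter> space P"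
    by (auto simp: space_P)
  finally show ?thesis by (simp add: cdf_def measure_distr)
qed

lemma score_measurable[measurable]: "score \<in> borel_measurable P"
proof -
  interpret D: real_distribution "distr P borel (\<lambda>z. f (fst z))" by (rule real_distribution_score)
  have "cdf (distr P borel (\<lambda>z. f (fst z))) \<in> borel_measurable borel"
    using D.cdf_nondecreasing by (intro borel_measurable_mono monoI)
  then have "(\<lambda>z. cdf (distr P borel (\<lambda>z. f (fst z))) (f (fst z))) \<in> borel_measurable P"
    by (rule measurable_compose[rotated]) measurable
  then show ?thesis by (simp add: score_eq_cdf[abs_def])
qed

lemma score_bounds: "0 \<le> score z \<and> score z \<le> 1"
proof -
  interpret D: real_distribution "distr P borel (\<lambda>z. f (fst z))" by (rule real_distribution_score)
  show ?thesis using D.cdf_nonneg D.cdf_bounded_prob by (simp add: score_eq_cdf)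
qed

lemma score_mono: "f (fst z) \<le> f (fst z') \<Longrightarrow> score z \<le> score z'"
proof -
  interpret D: real_distribution "distr P borel (\<lambda>z. f (fst z))" by (rule real_distribution_score)
  show "f (fst z) \<le> f (fst z') \<Longrightarrow> score z \<le> score z'"
    unfolding score_eq_cdf by (rule D.cdf_nondecreasing)
qed

lemma distr_score: "distr P borel score = uniform_measure lborel {0..1}"
proof -
  interpret D: real_distribution "distr P borel (\<lambda>z. f (fst z))" by (rule real_distribution_score)
  have "cdf (distr P borel (\<lambda>z. f (fst z))) \<in> borel_measurable borel"
    using D.cdf_nondecreasing by (intro borel_measurable_mono monoI)
  then have "distr P borel score
      = distr (distr P borel (\<lambda>z. f (fst z))) borel (cdf (distr P borel (\<lambda>z. f (fst z))))"
    by (subst distr_distr) (auto simp: comp_def score_eq_cdf[abs_def])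
  also have "\<dots> = uniform_measure lborel {0..1}"
    using atomless by (rule D.distr_cdf_atomless)
  finally show ?thesis .
qed

section \<open>Mean deviation of label sums and of the DCG\<close>

lemma prob_top_fraction:
  assumes "0 \<le> t" "t \<le> 1"
  shows "measure P {z \<in> space P. 1 - score z \<le> t} = t"
proof -
  have "measure P {z \<in> space P. 1 - score z \<le> t} = measure (distr P borel score) {1 - t..}"
    by (subst measure_distr) (auto intro!: arg_cong[where f="measure P"])
  also have "{0..1} \<inter> {1 - t..} = {1 - t..1}" using assms by auto
  then have "measure (distr P borel score) {1 - t..} = t"
    using assms by (simp add: distr_score measure_uniform_measure)
  finally show ?thesis .
qed

text \<open>\<open>A\<close> collects the points of depth at most \<open>t = r / n\<close> and
  \<open>B\<close> the positive ones among them. The expected count of \<open>A\<close> is exactly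
  \<open>r\<close>, so exchanging the top \<open>r\<close> ranks for the items in \<open>A\<close>
  costs only the deviation of that count. The expected count of \<open>B\<close> is at most
  \<open>r\<close>, so each deviation has mean at most \<open>sqrt r\<close>.\<close>

lemma expectation_ranked_label_deviation:
  assumes "r \<le> n" "0 < n"
  shows "expectation (\<lambda>\<omega>. \<bar>(\<Sum>s=1..r. ranked_label n s \<omega>) - real n * positive_mass (real r / real n)\<bar>)
    \<le> 2 * sqrt (real r)"
proof -
  define t where "t = real r / real n"
  have t: "0 \<le> t" "t \<le> 1" "real n * t = real r" using assms by (auto simp: t_def)
  define A B where "A = {z \<in> space P. 1 - score z \<le> t}"
    and "B = {z \<in> space P. snd z = 1 \<and> 1 - score z \<le> t}"
  have A: "A \<in> sets P" and B: "B \<in> sets P" unfolding A_def B_def by measurable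
  have pA: "measure P A = t" unfolding A_def using t by (intro prob_top_fraction)
  have "measure P B \<le> measure P A" using A by (intro P.finite_measure_mono) (auto simp: A_def B_def)
  then have pB: "real n * measure P B \<le> real r"
    using mult_left_mono[of "measure P B" t "real n"] pA t by simp
  define X where "X C \<omega> = (\<Sum>i=1..n. indicator C (Z i \<omega>)) - real n * measure P C" for C \<omega>
  have X_dev: "expectation (\<lambda>\<omega>. \<bar>X C \<omega>\<bar>) \<le> sqrt (real n * measure P C)"
    and X_int: "integrable M (\<lambda>\<omega>. \<bar>X C \<omega>\<bar>)" if "C \<in> sets P" for C
  proof -
    have C: "C \<in> sets (MX \<Otimes>\<^sub>M count_space {0, 1})" using that sets_P by simp
    have "indep_vars (\<lambda>_. MX \<Otimes>\<^sub>M count_space {0, 1}) Z {1..n}"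
      using indep_Z by (rule indep_vars_subset) auto
    from expectation_abs_count_deviation[OF this _ distr_Z C]
    show "expectation (\<lambda>\<omega>. \<bar>X C \<omega>\<bar>) \<le> sqrt (real n * measure P C)" by (simp add: X_def)
    have ind: "integrable M (\<lambda>\<omega>. indicator C (Z i \<omega>) :: real)" if "i \<in> {1..n}" for i
    proof (rule integrable_const_bound[where B=1])
      show "(\<lambda>\<omega>. indicator C (Z i \<omega>) :: real) \<in> borel_measurable M"
        by (rule measurable_compose[OF Z_measurable borel_measurable_indicator]) (use that C in auto)
    qed (auto simp: indicator_def)
    show "integrable M (\<lambda>\<omega>. \<bar>X C \<omega>\<bar>)"
      unfolding X_def using ind
      by (intro integrable_abs Bochner_Integration.integrable_diff Bochner_Integration.integrable_sum) auto
  qed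
  have bound: "\<bar>(\<Sum>s=1..r. ranked_label n s \<omega>) - real n * positive_mass t\<bar> \<le> \<bar>X A \<omega>\<bar> + \<bar>X B \<omega>\<bar>"
    if \<omega>: "\<omega> \<in> space M" for \<omega>
  proof -
    define S where "S = {i\<in>{1..n}. Z i \<omega> \<in> A}"
    have S_eq: "S = {i\<in>{1..n}. 1 - score (Z i \<omega>) \<le> t}"
      using Z_in_space \<omega> by (auto simp: S_def A_def)
    note perm = ranking_permutes[OF \<omega>, of n]
    have "\<bar>(\<Sum>s=1..r. real (snd (Z (\<rho> n (items n \<omega>) s) \<omega>))) - (\<Sum>i\<in>S. real (snd (Z i \<omega>)))\<bar>
        \<le> \<bar>real r - real (card S)\<bar>"
    proof (rule sum_top_labels_vs_upset[OF perm])
      fix a b assume ab: "a \<in> {1..n}" "b \<in> {1..n}" "a \<le> b" "\<rho> n (items n \<omega>) b \<in> S"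
      have "\<rho> n (items n \<omega>) a \<in> {1..n}" using permutes_in_image[OF perm] ab by blast
      \<comment> \<open>Items tied in \<open>f\<close> have equal scores, so membership in
        \<open>S\<close> is monotone along the ordering however ties are broken.\<close>
      moreover have "score (Z (\<rho> n (items n \<omega>) b) \<omega>) \<le> score (Z (\<rho> n (items n \<omega>) a) \<omega>)"
        using ab by (intro score_mono ranking_sorted[OF \<omega>])
      ultimately show "\<rho> n (items n \<omega>) a \<in> S" using ab(4) by (simp add: S_eq)
    next
      fix i assume "i \<in> {1..n}"
      then show "snd (Z i \<omega>) \<le> 1" using label_cases[of i \<omega>] \<omega> by auto
    qed (use assms in \<open>auto simp: S_def\<close>)
    moreover have "real (card S) = (\<Sum>i=1..n. indicator A (Z i \<omega>))"
      unfolding S_def indicator_def by (simp add: sum.If_cases Int_def)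
    moreover have "(\<Sum>i\<in>S. real (snd (Z i \<omega>))) = (\<Sum>i=1..n. indicator B (Z i \<omega>))"
    proof -
      have "(\<Sum>i\<in>S. real (snd (Z i \<omega>))) = (\<Sum>i=1..n. if Z i \<omega> \<in> A then real (snd (Z i \<omega>)) else 0)"
        unfolding S_def by (rule sum.inter_filter) simp
      also have "\<dots> = (\<Sum>i=1..n. indicator B (Z i \<omega>))"
      proof (intro sum.cong refl)
        fix i assume "i \<in> {1..n}"
        then show "(if Z i \<omega> \<in> A then real (snd (Z i \<omega>)) else 0) = indicator B (Z i \<omega>)"
          using label_cases[of i \<omega>] \<omega> by (auto simp: A_def B_def indicator_def)
      qed
      finally show ?thesis .
    qed
    ultimately have "\<bar>(\<Sum>s=1..r. ranked_label n s \<omega>) - (\<Sum>i=1..n. indicator B (Z i \<omega>))\<bar>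
        \<le> \<bar>(\<Sum>i=1..n. indicator A (Z i \<omega>)) - real r\<bar>"
      by (simp add: ranked_label_def abs_minus_commute)
    moreover have "positive_mass t = measure P B" by (simp only: positive_mass_def B_def)
    ultimately show ?thesis using pA t by (simp add: X_def)
  qed
  have "expectation (\<lambda>\<omega>. \<bar>(\<Sum>s=1..r. ranked_label n s \<omega>) - real n * positive_mass t\<bar>)
      \<le> expectation (\<lambda>\<omega>. \<bar>X A \<omega>\<bar> + \<bar>X B \<omega>\<bar>)"
    using bound X_int[OF A] X_int[OF B] by (intro integral_mono_AE') auto
  also have "\<dots> = expectation (\<lambda>\<omega>. \<bar>X A \<omega>\<bar>) + expectation (\<lambda>\<omega>. \<bar>X B \<omega>\<bar>)"
    using X_int[OF A] X_int[OF B] by simp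
  also have "\<dots> \<le> sqrt (real r) + sqrt (real r)"
    using X_dev[OF A] X_dev[OF B] pA pB t
    by (intro add_mono) (auto intro: order_trans)
  finally show ?thesis by (simp add: t_def)
qed

text \<open>Removes the lower boundary term in the summation by parts; depth 0 has probability 0
  because the score is uniform.\<close>

lemma positive_mass_0: "positive_mass 0 = 0"
proof -
  have "positive_mass 0 \<le> measure P {z \<in> space P. 1 - score z \<le> 0}"
    unfolding positive_mass_def by (intro P.finite_measure_mono) auto
  also have "\<dots> = 0" by (intro prob_top_fraction) auto
  finally show ?thesis by (simp add: positive_mass_def measure_le_0_iff)
qed

lemma ranked_label_integrable: "r \<in> {1..n} \<Longrightarrow> integrable M (ranked_label n r)"
  using ranked_label_bounds[of _ r n]
  by (intro integrable_const_bound[where B=1] ranked_label_measurable AE_I2) auto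

text \<open>Summation by parts writes the error through prefix deviations with nonnegative weights
  \<open>D r - D (Suc r)\<close>, so the first-moment bounds on prefixes can be inserted term by
  term.\<close>

lemma expectation_dcg_deviation:
  assumes dec: "\<And>r s. 1 \<le> r \<Longrightarrow> r \<le> s \<Longrightarrow> D s \<le> D r" and "D (Suc n) = 0" and "0 < n"
  shows "expectation (\<lambda>\<omega>. \<bar>(\<Sum>r=1..n. ranked_label n r \<omega> * D r) - real n * (\<Sum>r=1..n. D r *
            (positive_mass (real r / real n) - positive_mass (real (r - 1) / real n)))\<bar>)
    \<le> 2 * (\<Sum>r=1..n. D r * (sqrt (real r) - sqrt (real (r - 1))))"
proof -
  define \<Delta> where "\<Delta> r \<omega> = (\<Sum>s=1..r. ranked_label n s \<omega>) - real n * positive_mass (real r / real n)" for r \<omega>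
  have \<Delta>_int: "integrable M (\<lambda>\<omega>. \<bar>\<Delta> r \<omega>\<bar>)" if "r \<le> n" for r
    unfolding \<Delta>_def using that
    by (intro integrable_abs Bochner_Integration.integrable_diff Bochner_Integration.integrable_sum
        ranked_label_integrable) auto
  have diff: "(\<Sum>r=1..n. ranked_label n r \<omega> * D r) - real n * (\<Sum>r=1..n. D r *
      (positive_mass (real r / real n) - positive_mass (real (r - 1) / real n)))
      = (\<Sum>r=1..n. (D r - D (Suc r)) * \<Delta> r \<omega>)" for \<omega>
  proof -
    have step: "D r * (\<Delta> r \<omega> - \<Delta> (r - 1) \<omega>) = ranked_label n r \<omega> * D r
        - real n * (D r * (positive_mass (real r / real n) - positive_mass (real (r - 1) / real n)))"
      if "r \<in> {1..n}" for r
    proof -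
      obtain q where q: "r = Suc q" using \<open>r \<in> {1..n}\<close> by (cases r) auto
      show ?thesis unfolding \<Delta>_def q by (simp add: algebra_simps)
    qed
    have "(\<Sum>r=1..n. D r * (\<Delta> r \<omega> - \<Delta> (r - 1) \<omega>)) = (\<Sum>r=1..n. (D r - D (Suc r)) * \<Delta> r \<omega>)"
      unfolding summation_by_parts[of D "\<lambda>r. \<Delta> r \<omega>"] using assms(2) by (simp add: \<Delta>_def positive_mass_0)
    then show ?thesis
      by (simp only: sum.cong[OF refl step] sum_subtractf sum_distrib_left)
  qed
  have "expectation (\<lambda>\<omega>. \<bar>\<Sum>r=1..n. (D r - D (Suc r)) * \<Delta> r \<omega>\<bar>)
      \<le> expectation (\<lambda>\<omega>. \<Sum>r=1..n. (D r - D (Suc r)) * \<bar>\<Delta> r \<omega>\<bar>)"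
  proof (rule integral_mono_AE')
    show "integrable M (\<lambda>\<omega>. \<Sum>r=1..n. (D r - D (Suc r)) * \<bar>\<Delta> r \<omega>\<bar>)"
      using \<Delta>_int by (intro Bochner_Integration.integrable_sum integrable_mult_right) auto
    have "\<bar>\<Sum>r=1..n. (D r - D (Suc r)) * \<Delta> r \<omega>\<bar> \<le> (\<Sum>r=1..n. (D r - D (Suc r)) * \<bar>\<Delta> r \<omega>\<bar>)" for \<omega>
      using dec by (intro order_trans[OF sum_abs] sum_mono) (auto simp: abs_mult intro!: mult_right_mono)
    then show "AE \<omega> in M. \<bar>\<Sum>r=1..n. (D r - D (Suc r)) * \<Delta> r \<omega>\<bar> \<le> (\<Sum>r=1..n. (D r - D (Suc r)) * \<bar>\<Delta> r \<omega>\<bar>)"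
      by simp
    show "AE \<omega> in M. 0 \<le> (\<Sum>r=1..n. (D r - D (Suc r)) * \<bar>\<Delta> r \<omega>\<bar>)"
      using dec by (intro AE_I2 sum_nonneg mult_nonneg_nonneg) auto
  qed
  also have "\<dots> = (\<Sum>r=1..n. (D r - D (Suc r)) * expectation (\<lambda>\<omega>. \<bar>\<Delta> r \<omega>\<bar>))"
    using \<Delta>_int by (subst Bochner_Integration.integral_sum) auto
  also have "\<dots> \<le> (\<Sum>r=1..n. (D r - D (Suc r)) * (2 * sqrt (real r)))"
    unfolding \<Delta>_def using dec \<open>0 < n\<close>
    by (intro sum_mono mult_left_mono expectation_ranked_label_deviation) auto
  \<comment> \<open>Summation by parts in reverse, now for the deterministic bound
    \<open>2 * sqrt r\<close>.\<close>
  also have "\<dots> = (\<Sum>r=1..n. D r * (2 * sqrt (real r) - 2 * sqrt (real (r - 1))))"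
    unfolding summation_by_parts[of D "\<lambda>r. 2 * sqrt (real r)"] using assms(2) by simp
  also have "\<dots> = 2 * (\<Sum>r=1..n. D r * (sqrt (real r) - sqrt (real (r - 1))))"
    by (simp add: sum_distrib_left algebra_simps)
  finally show ?thesis by (simp only: diff)
qed

section \<open>Limit of the normalised DCG\<close>

lemma
  fixes h :: "real \<Rightarrow> real"
  assumes [measurable]: "h \<in> borel_measurable borel"
  shows integrable_score_iff: "integrable P (\<lambda>z. h (score z)) \<longleftrightarrow> set_integrable lborel {0..1} h"
    and integral_score: "(\<integral>z. h (score z) \<partial>P) = (LBINT u:{0..1}. h u)"
proof -
  have "integrable P (\<lambda>z. h (score z)) \<longleftrightarrow> integrable (distr P borel score) h"
    by (subst integrable_distr_eq) auto
  also have "\<dots> \<longleftrightarrow> set_integrable lborel {0..1} h"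
    unfolding distr_score uniform_unit_interval_eq_density set_integrable_def
    by (subst integrable_density) auto
  finally show "integrable P (\<lambda>z. h (score z)) \<longleftrightarrow> set_integrable lborel {0..1} h" .
  have "(\<integral>z. h (score z) \<partial>P) = integral\<^sup>L (distr P borel score) h"
    by (subst integral_distr) auto
  also have "\<dots> = (LBINT u:{0..1}. h u)"
    unfolding distr_score uniform_unit_interval_eq_density set_lebesgue_integral_def
    by (subst integral_density) auto
  finally show "(\<integral>z. h (score z) \<partial>P) = (LBINT u:{0..1}. h u)" .
qed

lemma AE_score_neq: "AE z in P. score z \<noteq> a"
proof -
  have "AE u in distr P borel score. u \<noteq> a"
    unfolding distr_score uniform_unit_interval_eq_density
    using AE_lborel_singleton[of a] by (subst AE_density) auto
  then show ?thesis by (subst (asm) AE_distr_iff) auto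
qed

text \<open>The centre is the deterministic sum of discounts times increments of
  \<open>positive_mass\<close>. After normalisation the mean deviation is of order
  \<open>n powr (- (1 - \<beta>) / 2)\<close>, and the centre converges by
  \<open>scaled_discount_increments_tendsto\<close> with \<open>V = 1 - score\<close>.\<close>

lemma dcg_converges_in_prob:
  assumes \<beta>: "0 < \<beta>" "\<beta> < 1" and c: "0 < c" "c < 1"
  shows "converges_in_prob M (\<lambda>n \<omega>. real n powr (\<beta> - 1) *
      (\<Sum>r=1..n. ranked_label n r \<omega> * cutoff_power_discount \<beta> (c * real n) r))
    (\<integral>z. indicator {z \<in> space P. snd z = 1} z *
       (if 1 - score z \<le> c then (1 - score z) powr (-\<beta>) else 0) \<partial>P)"
proof (rule converges_in_prob_mean)
  let ?D = "\<lambda>n. cutoff_power_discount \<beta> (c * real n)"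
  let ?G = "\<lambda>n. \<Sum>r=1..n. ?D n r * (positive_mass (real r / real n) - positive_mass (real (r - 1) / real n))"
  show "prob_space M" by unfold_locales
  show meas: "(\<lambda>\<omega>. real n powr (\<beta> - 1) * (\<Sum>r=1..n. ranked_label n r \<omega> * ?D n r)) \<in> borel_measurable M" for n
    by (intro borel_measurable_times borel_measurable_sum ranked_label_measurable) auto
  show "integrable M (\<lambda>\<omega>. real n powr (\<beta> - 1) * (\<Sum>r=1..n. ranked_label n r \<omega> * ?D n r))" for n
    by (intro integrable_mult_right Bochner_Integration.integrable_sum integrable_mult_left ranked_label_integrable)
  show "\<forall>\<^sub>F n in sequentially. expectation (\<lambda>\<omega>. \<bar>real n powr (\<beta> - 1) * (\<Sum>r=1..n. ranked_label n r \<omega> * ?D n r)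
      - real n powr \<beta> * ?G n\<bar>) \<le> 4 / (1 - \<beta>) * real n powr (- (1 - \<beta>) / 2)"
    using eventually_gt_at_top[of 0]
  proof eventually_elim
    case (elim n)
    \<comment> \<open>Proved after multiplication by \<open>sqrt r\<close>, using
      \<open>r - 1 \<le> sqrt r * sqrt (r - 1)\<close>.\<close>
    have "sqrt (real r) - sqrt (real (r - 1)) \<le> real r powr (-(1/2))" if "r \<in> {1..n}" for r
    proof -
      have "real r - 1 = sqrt (real (r - 1)) * sqrt (real (r - 1))" using that by (simp add: of_nat_diff)
      also have "\<dots> \<le> sqrt (real r) * sqrt (real (r - 1))" by (intro mult_right_mono) auto
      finally have "sqrt (real r) * (sqrt (real r) - sqrt (real (r - 1))) \<le> 1"
        by (simp add: right_diff_distrib)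
      then show ?thesis using that by (simp add: powr_minus powr_half_sqrt field_simps)
    qed
    then have "(\<Sum>r=1..n. ?D n r * (sqrt (real r) - sqrt (real (r - 1))))
        \<le> (\<Sum>r=1..n. real r powr (-\<beta>) * real r powr (-(1/2)))"
      by (intro sum_mono mult_mono cutoff_power_discount_le) auto
    \<comment> \<open>The exponent \<open>\<beta> + 1/2\<close> may reach or exceed 1. Weakening it
      to \<open>(1 + \<beta>) / 2\<close>, which stays below 1, lets \<open>sum_powr_bounds\<close>
      treat all \<open>\<beta>\<close> alike, and the resulting growth is still negligible.\<close>
    also have "\<dots> \<le> (\<Sum>r=1..n. real r powr (- ((1 + \<beta>) / 2)))"
    proof (intro sum_mono)
      fix r assume "r \<in> {1..n}"
      moreover have "-\<beta> - 1/2 \<le> - ((1 + \<beta>) / 2)" using \<beta> by (simp add: field_simps)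
      ultimately show "real r powr (-\<beta>) * real r powr (-(1/2)) \<le> real r powr (- ((1 + \<beta>) / 2))"
        by (simp add: powr_add[symmetric] powr_mono)
    qed
    also have "\<dots> \<le> real n powr (1 - (1 + \<beta>) / 2) / (1 - (1 + \<beta>) / 2)"
      using \<beta> by (intro sum_powr_bounds) auto
    also have "\<dots> = 2 / (1 - \<beta>) * real n powr ((1 - \<beta>) / 2)"
      using \<beta> by (simp add: field_simps)
    finally have sum_bound: "(\<Sum>r=1..n. ?D n r * (sqrt (real r) - sqrt (real (r - 1))))
        \<le> 2 / (1 - \<beta>) * real n powr ((1 - \<beta>) / 2)" .
    \<comment> \<open>Since \<open>c < 1\<close>, the cutoff falls before rank \<open>Suc n\<close>,
      which kills the upper boundary term.\<close>
    have "c * real n < real (Suc n)" using c elim by (simp add: mult_left_le_one_le add_strict_increasing)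
    then have "?D n (Suc n) = 0" by (simp add: cutoff_power_discount_def)
    with elim have "expectation (\<lambda>\<omega>. \<bar>(\<Sum>r=1..n. ranked_label n r \<omega> * ?D n r) - real n * ?G n\<bar>)
        \<le> 2 * (\<Sum>r=1..n. ?D n r * (sqrt (real r) - sqrt (real (r - 1))))"
      using \<beta> by (intro expectation_dcg_deviation cutoff_power_discount_decreasing) auto
    also have "\<dots> \<le> 2 * (2 / (1 - \<beta>) * real n powr ((1 - \<beta>) / 2))"
      using sum_bound by (rule mult_left_mono) simp
    finally have dev: "expectation (\<lambda>\<omega>. \<bar>(\<Sum>r=1..n. ranked_label n r \<omega> * ?D n r) - real n * ?G n\<bar>)
        \<le> 4 / (1 - \<beta>) * real n powr ((1 - \<beta>) / 2)" by simp
    have "real n powr \<beta> = real n powr (\<beta> - 1) * real n"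
      using elim by (simp add: powr_diff)
    then have "\<bar>real n powr (\<beta> - 1) * X - real n powr \<beta> * ?G n\<bar> = real n powr (\<beta> - 1) * \<bar>X - real n * ?G n\<bar>" for X
      by (simp add: abs_mult right_diff_distrib[symmetric] mult.assoc)
    then have "expectation (\<lambda>\<omega>. \<bar>real n powr (\<beta> - 1) * (\<Sum>r=1..n. ranked_label n r \<omega> * ?D n r) - real n powr \<beta> * ?G n\<bar>)
      = real n powr (\<beta> - 1) * expectation (\<lambda>\<omega>. \<bar>(\<Sum>r=1..n. ranked_label n r \<omega> * ?D n r) - real n * ?G n\<bar>)"
      by simp
    also have "\<dots> \<le> real n powr (\<beta> - 1) * (4 / (1 - \<beta>) * real n powr ((1 - \<beta>) / 2))"
      using dev by (rule mult_left_mono) simp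
    also have "\<dots> = 4 / (1 - \<beta>) * (real n powr (\<beta> - 1) * real n powr ((1 - \<beta>) / 2))" by simp
    also have "real n powr (\<beta> - 1) * real n powr ((1 - \<beta>) / 2) = real n powr (- (1 - \<beta>) / 2)"
      unfolding powr_add[symmetric] by (rule arg_cong[where f="\<lambda>e. real n powr e"]) (simp add: field_simps)
    finally show ?case .
  qed
  have "(\<lambda>n. real n powr (- (1 - \<beta>) / 2)) \<longlonglongrightarrow> 0"
    using \<beta> by (intro tendsto_neg_powr filterlim_real_sequentially) auto
  from tendsto_mult[OF tendsto_const[of "4 / (1 - \<beta>)"] this]
  show "(\<lambda>n. 4 / (1 - \<beta>) * real n powr (- (1 - \<beta>) / 2)) \<longlonglongrightarrow> 0" by simp
  have "(\<lambda>n. real n powr \<beta> * (\<Sum>r=1..n. ?D n r *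
      (measure P {z \<in> {z \<in> space P. snd z = 1}. 1 - score z \<le> real r / real n}
        - measure P {z \<in> {z \<in> space P. snd z = 1}. 1 - score z \<le> real (r - 1) / real n})))
    \<longlonglongrightarrow> (\<integral>z. indicator {z \<in> space P. snd z = 1} z *
       (if 1 - score z \<le> c then (1 - score z) powr (-\<beta>) else 0) \<partial>P)"
  proof (rule scaled_discount_increments_tendsto)
    show "integrable P (\<lambda>z. (1 - score z) powr (-\<beta>))"
      using \<beta> by (subst integrable_score_iff) (auto intro: set_integrable_powr_unit_interval)
    show "AE z in P. 1 - score z \<noteq> c"
      using AE_score_neq[of "1 - c"] by eventually_elim auto
  qed (use \<beta> c score_bounds in \<open>auto intro: prob_P\<close>)
  moreover have "{z \<in> {z \<in> space P. snd z = 1}. 1 - score z \<le> t} = {z \<in> space P. snd z = 1 \<and> 1 - score z \<le> t}" for t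
    by auto
  ultimately show "(\<lambda>n. real n powr \<beta> * ?G n) \<longlonglongrightarrow> (\<integral>z. indicator {z \<in> space P. snd z = 1} z *
       (if 1 - score z \<le> c then (1 - score z) powr (-\<beta>) else 0) \<partial>P)"
    by (simp only: positive_mass_def)
qed

section \<open>Number of positives, ideal DCG and the ratio\<close>

definition positives :: "nat \<Rightarrow> 'w \<Rightarrow> nat" where
  "positives n \<omega> = (\<Sum>i=1..n. snd (Z i \<omega>))"

text \<open>For arbitrary \<open>g\<close> the count must be measurable into a discrete space;
  taking the floor of the real-valued label sum achieves this.\<close>

lemma positives_measurable: "(\<lambda>\<omega>. g (positives n \<omega>)) \<in> borel_measurable M" for g :: "nat \<Rightarrow> real"
proof -
  have "(\<lambda>\<omega>. \<Sum>i=1..n. real (snd (Z i \<omega>))) \<in> borel_measurable M"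
    by (intro borel_measurable_sum label_measurable) auto
  then have "(\<lambda>\<omega>. \<lfloor>\<Sum>i=1..n. real (snd (Z i \<omega>))\<rfloor>) \<in> measurable M (count_space UNIV)"
    by (rule measurable_compose) (rule measurable_real_floor)
  then have "(\<lambda>\<omega>. g (nat \<lfloor>\<Sum>i=1..n. real (snd (Z i \<omega>))\<rfloor>)) \<in> borel_measurable M"
    by (rule measurable_compose) simp
  then show ?thesis by (simp add: positives_def flip: of_nat_sum)
qed

lemma positives_le: "\<omega> \<in> space M \<Longrightarrow> positives n \<omega> \<le> n"
proof -
  assume "\<omega> \<in> space M"
  then have "snd (Z i \<omega>) \<le> 1" if "i \<in> {1..n}" for i using label_cases[of i \<omega>] that by auto
  then have "positives n \<omega> \<le> (\<Sum>i=1..n. 1)" unfolding positives_def by (rule sum_mono)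
  then show ?thesis by simp
qed

text \<open>The weak law with a rate, from the same counting bound as the DCG.\<close>

lemma positives_converges_in_prob:
  "converges_in_prob M (\<lambda>n \<omega>. real (positives n \<omega>) / real n) (measure P {z \<in> space P. snd z = 1})"
proof (rule converges_in_prob_mean[where a="\<lambda>_. measure P {z \<in> space P. snd z = 1}" and e="\<lambda>n. 1 / sqrt (real n)"])
  let ?A = "{z \<in> space P. snd z = 1}"
  have A: "?A \<in> sets P" by measurable
  show "prob_space M" by unfold_locales
  show meas: "(\<lambda>\<omega>. real (positives n \<omega>) / real n) \<in> borel_measurable M" for n
    by (rule positives_measurable)
  show "integrable M (\<lambda>\<omega>. real (positives n \<omega>) / real n)" for n
  proof (rule integrable_const_bound[where B=1])
    show "AE \<omega> in M. norm (real (positives n \<omega>) / real n) \<le> 1"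
      using positives_le by (intro AE_I2) (auto simp: divide_le_eq_1)
  qed (rule meas)
  show "\<forall>\<^sub>F n in sequentially. expectation (\<lambda>\<omega>. \<bar>real (positives n \<omega>) / real n - measure P ?A\<bar>) \<le> 1 / sqrt (real n)"
    using eventually_gt_at_top[of 0]
  proof eventually_elim
    case (elim n)
    have "indep_vars (\<lambda>_. MX \<Otimes>\<^sub>M count_space {0, 1}) Z {1..n}"
      using indep_Z by (rule indep_vars_subset) auto
    from expectation_abs_count_deviation[OF this _ distr_Z, of ?A] A
    have dev: "expectation (\<lambda>\<omega>. \<bar>(\<Sum>i=1..n. indicator ?A (Z i \<omega>)) - real n * measure P ?A\<bar>)
        \<le> sqrt (real n * measure P ?A)" by (simp add: sets_P)
    have "\<bar>real (positives n \<omega>) / real n - measure P ?A\<bar>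
        = \<bar>(\<Sum>i=1..n. indicator ?A (Z i \<omega>)) - real n * measure P ?A\<bar> / real n" if "\<omega> \<in> space M" for \<omega>
    proof -
      have "real (positives n \<omega>) = (\<Sum>i=1..n. indicator ?A (Z i \<omega>))"
        unfolding positives_def of_nat_sum
      proof (intro sum.cong refl)
        fix i assume "i \<in> {1..n}"
        then show "real (snd (Z i \<omega>)) = indicator ?A (Z i \<omega>)"
          using label_cases[of i \<omega>] Z_in_space[of i \<omega>] that by (auto simp: indicator_def)
      qed
      then have "real (positives n \<omega>) / real n - measure P ?A
          = ((\<Sum>i=1..n. indicator ?A (Z i \<omega>)) - real n * measure P ?A) / real n"
        using elim by (simp add: diff_divide_distrib)
      then show ?thesis by simp
    qed
    then have "expectation (\<lambda>\<omega>. \<bar>real (positives n \<omega>) / real n - measure P ?A\<bar>)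
        = expectation (\<lambda>\<omega>. \<bar>(\<Sum>i=1..n. indicator ?A (Z i \<omega>)) - real n * measure P ?A\<bar> / real n)"
      by (rule Bochner_Integration.integral_cong[OF refl])
    also have "\<dots> \<le> sqrt (real n * measure P ?A) / real n"
      using dev by (simp add: divide_right_mono)
    also have "\<dots> \<le> sqrt (real n) / real n"
      by (intro divide_right_mono) (auto intro: mult_left_le)
    also have "\<dots> = 1 / sqrt (real n)" using elim by (simp add: field_simps)
    finally show ?case .
  qed
  have "(\<lambda>n. sqrt (1 / real n)) \<longlonglongrightarrow> sqrt 0" by (intro tendsto_real_sqrt lim_1_over_n)
  then show "(\<lambda>n. 1 / sqrt (real n)) \<longlonglongrightarrow> 0" by (simp add: real_sqrt_divide)
qed simp

lemma idcg_eq: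
  assumes "\<omega> \<in> space M" "0 \<le> \<beta>" "0 \<le> c"
  shows "idcg (cutoff_power_discount \<beta> (c * real n)) n (\<lambda>i. snd (Z i \<omega>))
    = (\<Sum>r=1..min (positives n \<omega>) (nat \<lfloor>c * real n\<rfloor>). real r powr (-\<beta>))"
proof -
  have "idcg (cutoff_power_discount \<beta> (c * real n)) n (\<lambda>i. snd (Z i \<omega>))
      = (\<Sum>r=1..positives n \<omega>. cutoff_power_discount \<beta> (c * real n) r)"
    unfolding positives_def
  proof (rule idcg_binary)
    show "snd (Z i \<omega>) \<in> {0, 1}" if "i \<in> {1..n}" for i using label_cases[of i \<omega>] that assms by simp
  qed (use assms in \<open>auto intro: cutoff_power_discount_decreasing\<close>)
  also have "\<dots> = (\<Sum>r=1..min (positives n \<omega>) (nat \<lfloor>c * real n\<rfloor>). real r powr (-\<beta>))"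
    using assms by (intro sum_cutoff_power_discount) simp
  finally show ?thesis .
qed

text \<open>\<open>W\<close> is the normalised ideal DCG and \<open>U\<close> replaces its power sum
  by the leading term. \<open>U\<close> is a continuous function of the fraction of positives and of
  the cutoff fraction, which tend to \<open>p\<close> and \<open>c\<close>; the difference vanishes
  uniformly.\<close>

lemma idcg_converges_in_prob:
  assumes \<beta>: "0 < \<beta>" "\<beta> < 1" and c: "0 < c" and p: "p = measure P {z \<in> space P. snd z = 1}" "0 < p"
  shows "converges_in_prob M
    (\<lambda>n \<omega>. real n powr (\<beta> - 1) * idcg (cutoff_power_discount \<beta> (c * real n)) n (\<lambda>i. snd (Z i \<omega>)))
    (min c p powr (1 - \<beta>) / (1 - \<beta>))"
proof -
  let ?k = "\<lambda>n. nat \<lfloor>c * real n\<rfloor>"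
  define U where "U n \<omega> = min (real (positives n \<omega>) / real n) (real (?k n) / real n) powr (1 - \<beta>) / (1 - \<beta>)" for n \<omega>
  define W where "W n \<omega> = real n powr (\<beta> - 1) * (\<Sum>r=1..min (positives n \<omega>) (?k n). real r powr (-\<beta>))" for n \<omega>
  have U_meas: "U n \<in> borel_measurable M" for n
    unfolding U_def[abs_def] by (rule positives_measurable)
  have W_meas: "W n \<in> borel_measurable M" for n
    unfolding W_def[abs_def] by (rule positives_measurable)
  have U_conv: "converges_in_prob M U (min p c powr (1 - \<beta>) / (1 - \<beta>))"
    unfolding U_def[abs_def]
  proof (rule converges_in_prob_continuous[where g="\<lambda>u v. min u v powr (1 - \<beta>) / (1 - \<beta>)"])
    show "converges_in_prob M (\<lambda>n \<omega>. real (positives n \<omega>) / real n) p"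
      unfolding p(1) by (rule positives_converges_in_prob)
    show "converges_in_prob M (\<lambda>n \<omega>. real (?k n) / real n) c"
      using c by (intro converges_in_prob_const floor_fraction_tendsto) (auto intro: prob_space_axioms)
    show "isCont (\<lambda>(u, v). min u v powr (1 - \<beta>) / (1 - \<beta>)) (p, c)"
      unfolding case_prod_unfold isCont_def using p(2) c \<beta>
      by (intro tendsto_intros tendsto_min) auto
    show "(\<lambda>\<omega>. min (real (positives n \<omega>) / real n) (real (?k n) / real n) powr (1 - \<beta>) / (1 - \<beta>)) \<in> borel_measurable M" for n
      by (rule positives_measurable)
  qed (rule prob_space_axioms)
  \<comment> \<open>The gap between the two bounds of \<open>sum_powr_bounds\<close> is
    \<open>1 / (1 - \<beta>)\<close> for every upper limit \<open>m\<close>, so the error is free of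
    randomness. For \<open>n = 0\<close> everything is 0.\<close>
  have err: "\<bar>W n \<omega> - U n \<omega>\<bar> \<le> real n powr (\<beta> - 1) / (1 - \<beta>)" for n \<omega>
  proof (cases "n = 0")
    case False
    define m where "m = min (positives n \<omega>) (?k n)"
    have "min (real (positives n \<omega>) / real n) (real (?k n) / real n) = real m / real n"
      by (auto simp: m_def min_def divide_le_cancel)
    then have "U n \<omega> = (real m / real n) powr (1 - \<beta>) / (1 - \<beta>)" by (simp only: U_def)
    moreover have "real n powr (\<beta> - 1) = 1 / real n powr (1 - \<beta>)"
      using powr_minus_divide[of "real n" "1 - \<beta>"] by simp
    ultimately have "U n \<omega> = real n powr (\<beta> - 1) * (real m powr (1 - \<beta>) / (1 - \<beta>))"
      by (simp add: powr_divide)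
    then have "W n \<omega> - U n \<omega> = real n powr (\<beta> - 1) * ((\<Sum>r=1..m. real r powr (-\<beta>)) - real m powr (1 - \<beta>) / (1 - \<beta>))"
      by (simp add: W_def m_def right_diff_distrib)
    moreover have "\<bar>(\<Sum>r=1..m. real r powr (-\<beta>)) - real m powr (1 - \<beta>) / (1 - \<beta>)\<bar> \<le> 1 / (1 - \<beta>)"
      using sum_powr_bounds[OF \<beta>, of m] by (auto simp: diff_divide_distrib)
    ultimately show ?thesis
      using mult_left_mono[of "\<bar>(\<Sum>r=1..m. real r powr (-\<beta>)) - real m powr (1 - \<beta>) / (1 - \<beta>)\<bar>" "1 / (1 - \<beta>)" "real n powr (\<beta> - 1)"]
      by (simp add: abs_mult)
  qed (simp add: U_def W_def)
  have err_int: "integrable M (\<lambda>\<omega>. W n \<omega> - U n \<omega>)" for n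
    using err W_meas U_meas by (intro integrable_const_bound[where B="real n powr (\<beta> - 1) / (1 - \<beta>)"]) auto
  have err_conv: "converges_in_prob M (\<lambda>n \<omega>. W n \<omega> - U n \<omega>) 0"
  proof (rule converges_in_prob_mean[where a="\<lambda>_. 0"])
    have "expectation (\<lambda>\<omega>. \<bar>W n \<omega> - U n \<omega>\<bar>) \<le> real n powr (\<beta> - 1) / (1 - \<beta>)" for n
      using err err_int by (intro integral_le_const) auto
    then show "\<forall>\<^sub>F n in sequentially. expectation (\<lambda>\<omega>. \<bar>W n \<omega> - U n \<omega> - 0\<bar>) \<le> real n powr (\<beta> - 1) / (1 - \<beta>)"
      by simp
    have "(\<lambda>n. real n powr (\<beta> - 1)) \<longlonglongrightarrow> 0"
      using \<beta> by (intro tendsto_neg_powr filterlim_real_sequentially) auto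
    from tendsto_divide[OF this tendsto_const[of "1 - \<beta>"]] \<beta>
    show "(\<lambda>n. real n powr (\<beta> - 1) / (1 - \<beta>)) \<longlonglongrightarrow> 0" by simp
  qed (use W_meas U_meas err_int in \<open>auto intro: prob_space_axioms\<close>)
  have "converges_in_prob M (\<lambda>n \<omega>. U n \<omega> + (W n \<omega> - U n \<omega>)) (min p c powr (1 - \<beta>) / (1 - \<beta>) + 0)"
  proof (rule converges_in_prob_continuous[OF prob_space_axioms U_conv err_conv])
    show "isCont (\<lambda>(u, v). u + v) (min p c powr (1 - \<beta>) / (1 - \<beta>), 0)"
      unfolding case_prod_unfold isCont_def by (intro tendsto_intros)
  qed (use W_meas U_meas in auto)
  then have "converges_in_prob M W (min c p powr (1 - \<beta>) / (1 - \<beta>))"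
    by (simp add: min.commute)
  then show ?thesis
    using idcg_eq \<beta> c by (subst converges_in_prob_cong[where Y=W]) (auto simp: W_def)
qed

text \<open>The common factor \<open>n powr (\<beta> - 1)\<close> cancels in the quotient, so the
  limits of numerator and denominator combine by continuity of division at a positive
  denominator.\<close>

lemma ndcg_converges_in_prob:
  assumes \<beta>: "0 < \<beta>" "\<beta> < 1" and c: "0 < c" "c < 1"
    and p: "p = measure P {z \<in> space P. snd z = 1}" "0 < p"
  shows "converges_in_prob M (\<lambda>n \<omega>. ndcg (cutoff_power_discount \<beta> (c * real n)) \<rho> n (\<lambda>i. Z i \<omega>))
    ((1 - \<beta>) / min c p powr (1 - \<beta>) * (\<integral>z. indicator {z \<in> space P. snd z = 1} z *
       (if 1 - score z \<le> c then (1 - score z) powr (-\<beta>) else 0) \<partial>P))"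
proof -
  let ?D = "\<lambda>n. cutoff_power_discount \<beta> (c * real n)"
  let ?L = "\<integral>z. indicator {z \<in> space P. snd z = 1} z *
       (if 1 - score z \<le> c then (1 - score z) powr (-\<beta>) else 0) \<partial>P"
  let ?w = "min c p powr (1 - \<beta>) / (1 - \<beta>)"
  let ?g = "\<lambda>x y :: real. if y = 0 then 1 else x / y"
  define X where "X n \<omega> = real n powr (\<beta> - 1) * (\<Sum>r=1..n. ranked_label n r \<omega> * ?D n r)" for n \<omega>
  define W where "W n \<omega> = real n powr (\<beta> - 1) * idcg (?D n) n (\<lambda>i. snd (Z i \<omega>))" for n \<omega>
  have X: "converges_in_prob M X ?L"
    unfolding X_def[abs_def] using \<beta> c by (rule dcg_converges_in_prob)
  have W: "converges_in_prob M W ?w"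
    unfolding W_def[abs_def] using \<beta> c(1) p by (rule idcg_converges_in_prob)
  have w: "?w > 0" using \<beta> c p by simp
  have "isCont (\<lambda>(u, v). ?g u v) (?L, ?w)"
    using w by (intro isCont_ratio_default less_imp_neq[THEN not_sym])
  moreover have "(\<lambda>\<omega>. ?g (X n \<omega>) (W n \<omega>)) \<in> borel_measurable M" for n
  proof -
    have [measurable]: "X n \<in> borel_measurable M" "W n \<in> borel_measurable M"
      using X W by (auto simp: converges_in_prob_def)
    show ?thesis by measurable
  qed
  ultimately have conv: "converges_in_prob M (\<lambda>n \<omega>. ?g (X n \<omega>) (W n \<omega>)) (?g ?L ?w)"
    by (rule converges_in_prob_continuous[OF prob_space_axioms X W])
  \<comment> \<open>For \<open>n > 0\<close> the factor is nonzero, so the default branch is taken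
    under the same condition on both sides; for \<open>n = 0\<close> both sides equal the default
    1.\<close>
  have eq: "ndcg (?D n) \<rho> n (\<lambda>i. Z i \<omega>) = ?g (X n \<omega>) (W n \<omega>)" if "\<omega> \<in> space M" for n \<omega>
  proof (cases "n = 0")
    case True
    then show ?thesis using idcg_eq[OF that, of \<beta> c 0] \<beta> c by (simp add: ndcg_def W_def Let_def)
  next
    case False
    have "dcg (?D n) n (\<rho> n (\<lambda>i\<in>{1..n}. fst (Z i \<omega>))) (\<lambda>i. snd (Z i \<omega>)) = (\<Sum>r=1..n. ranked_label n r \<omega> * ?D n r)"
      by (simp add: dcg_def ranked_label_def items_def)
    then show ?thesis using False by (simp add: ndcg_def X_def W_def Let_def)
  qed
  have "?g ?L ?w = (1 - \<beta>) / min c p powr (1 - \<beta>) * ?L"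
    unfolding if_not_P[OF less_imp_neq[OF w, THEN not_sym]] by simp
  then show ?thesis using conv by (subst converges_in_prob_cong[OF eq]) simp_all
qed

end

text \<open>It remains to rewrite the limit: conditioning on the score replaces the label by
  \<open>ybar\<close>, and uniformity of the score turns the expectation into a Lebesgue
  integral.\<close>

theorem theorem9:
  fixes MX :: "'x measure" and P :: "('x \<times> nat) measure"
    and M :: "'w measure" and Z :: "nat \<Rightarrow> 'w \<Rightarrow> 'x \<times> nat"
    and f :: "'x \<Rightarrow> real" and \<rho> :: "nat \<Rightarrow> (nat \<Rightarrow> 'x) \<Rightarrow> nat \<Rightarrow> nat"
    and ybar :: "real \<Rightarrow> real" and p \<beta> c :: real
  assumes "prob_space P"
    and "sets P = sets (MX \<Otimes>\<^sub>M count_space {0, 1})"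
    and "p = measure P {z \<in> space P. snd z = 1}" and "p > 0"
    and "prob_space M"
    and "prob_space.indep_vars M (\<lambda>_. MX \<Otimes>\<^sub>M count_space {0, 1}) Z {1..}"
    and "\<And>i. i \<ge> 1 \<Longrightarrow> distr M (MX \<Otimes>\<^sub>M count_space {0, 1}) (Z i) = P"
    and "0 < \<beta>" and "\<beta> < 1"
    and "0 < c" and "c < 1"
    and "f \<in> borel_measurable MX"
    and "ranking_rule MX f \<rho>"
    and "\<And>a. measure (distr P borel (\<lambda>z. f (fst z))) {a} = 0"
    and "cond_prob_version P {z \<in> space P. snd z = 1}
           (\<lambda>z. canonical (distr P MX fst) f (fst z)) ybar"
    and "continuous_on {0..1} ybar"
  shows "converges_in_prob M
    (\<lambda>n \<omega>. ndcg (cutoff_power_discount \<beta> (c * real n)) \<rho> n (\<lambda>i. Z i \<omega>))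
    ((1 - \<beta>) / (min c p) powr (1 - \<beta>) *
       (LBINT s:{1-c..1}. ybar s * (1 - s) powr (-\<beta>)))"
proof -
  interpret iid_ranking M MX P Z f \<rho>
    using assms(1,2,5,6,7,12,13,14) by (simp add: iid_ranking_def iid_ranking_axioms_def)
  \<comment> \<open>\<open>ybar\<close> is continuous only on the unit interval; extension by zero
    gives a Borel function that agrees with it at every score.\<close>
  define g where "g u = indicator {0..1} u * ybar u" for u
  define \<phi> where "\<phi> u = (if 1 - u \<le> c then (1 - u) powr (-\<beta>) else 0)" for u
  have [measurable]: "\<phi> \<in> borel_measurable borel" unfolding \<phi>_def[abs_def] by measurable
  have [measurable]: "g \<in> borel_measurable borel"
    unfolding g_def[abs_def] using borel_measurable_continuous_on_indicator[OF _ assms(16)] by simp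
  have ybar_score: "ybar (score z) = g (score z)" for z
    using score_bounds[of z] by (simp add: g_def)
  have "(\<integral>z. indicator {z \<in> space P. snd z = 1} z * \<phi> (score z) \<partial>P)
      = (\<integral>z. ybar (score z) * \<phi> (score z) \<partial>P)"
  proof (rule cond_prob_version_expectation)
    show "cond_prob_version P {z \<in> space P. snd z = 1} score ybar"
      using assms(15) by (simp add: score_def[abs_def])
    have "set_integrable lborel {0..1} \<phi>"
      using set_integrable_powr_unit_interval[OF assms(9)]
      by (rule set_integrable_bound) (auto simp: \<phi>_def set_borel_measurable_def)
    then show "integrable P (\<lambda>z. \<phi> (score z))" by (simp add: integrable_score_iff)
  qed (auto simp: ybar_score intro: prob_P)
  also have "\<dots> = (\<integral>z. (\<lambda>u. g u * \<phi> u) (score z) \<partial>P)" by (simp add: ybar_score)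
  also have "\<dots> = (LBINT u:{0..1}. g u * \<phi> u)" by (rule integral_score) measurable
  \<comment> \<open>The cutoff \<open>1 - u \<le> c\<close> inside \<open>\<phi>\<close> shrinks the
    unit interval to \<open>{1-c..1}\<close>, where \<open>c < 1\<close> keeps the left end
    nonnegative.\<close>
  also have "\<dots> = (LBINT s:{1-c..1}. ybar s * (1 - s) powr (-\<beta>))"
    unfolding set_lebesgue_integral_def g_def \<phi>_def using assms(10,11)
    by (intro Bochner_Integration.integral_cong refl) (auto simp: indicator_def)
  finally show ?thesis
    using ndcg_converges_in_prob[OF assms(8-11) assms(3,4)] by (simp add: \<phi>_def)
qed

end
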